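(* Let $|q|<1$, $\alpha\in\mathbb{C}$ and $\max\{|a|,|b|,|c|,|d|,|u|,|v|\}<1$. Then \[ \frac{(q;q)_\infty}{2\pi}\int_0^\pi\frac{h(\cos2\theta;1)}{h(\cos\theta;a,b,c,u,v)}\,{}_3\phi_2\!\left({{\alpha,\ ve^{i\theta},\ ve^{-i\theta}}\atop{\alpha dv,\ uv}};q,du\right)d\theta =\frac{(dv;q)_\infty}{(1-q)v(q,u/v,qv/u,\alpha dv,uv,ab,ac,bc;q)_\infty}\int_u^v\frac{(qx/u,qx/v,abcx,\alpha dx;q)_\infty}{(ax,bx,cx,dx;q)_\infty}\,d_qx. \]
   Context: $(a;q)_n=\prod_{k=0}^{n-1}(1-aq^k)$, $(a;q)_\infty=\prod_{k\ge0}(1-aq^k)$, $(a_1,\ldots,a_m;q)_n=(a_1;q)_n\cdots(a_m;q)_n$. The basic hypergeometric series is ${}_{r}\phi_{r-1}\!\left({{a_1,\ldots,a_r}\atop{b_1,\ldots,b_{r-1}}};q,z\right)=\sum_{n=0}^\infty\frac{(a_1,\ldots,a_r;q)_n}{(q,b_1,\ldots,b_{r-1};q)_n}z^n$. The Jackson $q$-integral is $\int_a^b g(x)\,d_qx=(1-q)\sum_{n=0}^\infty[bg(bq^n)-ag(aq^n)]q^n$. For $x=\cos\theta$, $h(x;a)=(ae^{i\theta},ae^{-i\theta};q)_\infty$ and $h(x;a_1,\ldots,a_m)=h(x;a_1)\cdots h(x;a_m)$. *)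

theory Defs
  imports "HOL-Analysis.Analysis"
begin

definition qpoch :: "complex \<Rightarrow> complex \<Rightarrow> nat \<Rightarrow> complex" where
  "qpoch a q n = (\<Prod>k<n. 1 - a * q ^ k)"

definition qpoch_inf :: "complex \<Rightarrow> complex \<Rightarrow> complex" where
  "qpoch_inf a q = (\<Prod>k. 1 - a * q ^ k)"

definition qpochs :: "complex list \<Rightarrow> complex \<Rightarrow> nat \<Rightarrow> complex" where
  "qpochs as q n = (\<Prod>a\<leftarrow>as. qpoch a q n)"

definition qpochs_inf :: "complex list \<Rightarrow> complex \<Rightarrow> complex" where
  "qpochs_inf as q = (\<Prod>a\<leftarrow>as. qpoch_inf a q)"

text \<open>
  The series with upper parameters \<open>as\<close> and lower parameters \<open>bs\<close>. It is the usual basic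
  hypergeometric series only if \<open>length as = length bs + 1\<close>; for other lengths the standard
  definition has an additional factor, which is not included here.
\<close>

definition basic_hyp :: "complex list \<Rightarrow> complex list \<Rightarrow> complex \<Rightarrow> complex \<Rightarrow> complex" where
  "basic_hyp as bs q z = (\<Sum>n. qpochs as q n / qpochs (q # bs) q n * z ^ n)"

definition jackson_integral ::
    "complex \<Rightarrow> complex \<Rightarrow> complex \<Rightarrow> (complex \<Rightarrow> complex) \<Rightarrow> complex" where
  "jackson_integral q a b g = (1 - q) * (\<Sum>n. (b * g (b * q ^ n) - a * g (a * q ^ n)) * q ^ n)"

text \<open>
  \<open>hfun q x a\<close> is \<open>h(x;a)\<close> for \<open>-1 \<le> x \<le> 1\<close>, where \<open>x = cos \<theta>\<close>. The definition takes
  \<open>\<theta> = arccos x\<close>; by \<open>hfun_cos\<close> below any other \<open>\<theta>\<close> with \<open>x = cos \<theta>\<close> gives the same value.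
\<close>

definition hfun :: "complex \<Rightarrow> real \<Rightarrow> complex \<Rightarrow> complex" where
  "hfun q x a = qpochs_inf [a * exp (\<i> * of_real (arccos x)), a * exp (- \<i> * of_real (arccos x))] q"

definition hfuns :: "complex \<Rightarrow> real \<Rightarrow> complex list \<Rightarrow> complex" where
  "hfuns q x as = (\<Prod>a\<leftarrow>as. hfun q x a)"

lemma hfun_cos:
  "hfun q (cos \<theta>) a = qpochs_inf [a * exp (\<i> * of_real \<theta>), a * exp (- \<i> * of_real \<theta>)] q"
proof -
  define t where "t = arccos (cos \<theta>)"
  have c: "cos t = cos \<theta>" by (simp add: t_def)
  have e: "exp (\<i> * of_real s) = cis s" "exp (- \<i> * of_real s) = cis (- s)" for s :: real
    by (simp_all add: cis_conv_exp)
  have "sin t ^ 2 = sin \<theta> ^ 2"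
    by (simp add: sin_squared_eq c)
  then have "sin t = sin \<theta> \<or> sin t = - sin \<theta>"
    by (simp add: power2_eq_iff)
  then have "cis t = cis \<theta> \<and> cis (- t) = cis (- \<theta>) \<or> cis t = cis (- \<theta>) \<and> cis (- t) = cis \<theta>"
    using c by (auto simp: complex_eq_iff)
  then show ?thesis
    unfolding hfun_def t_def [symmetric] e qpochs_inf_def by auto
qed

end

theory Submission
  imports Defs "HOL-Complex_Analysis.Complex_Analysis"
begin

text \<open>
  By the Askey--Wilson integral, \<open>(abcx;q)\<^sub>\<infinity> / (ax,bx,cx;q)\<^sub>\<infinity>\<close> is, up to a factor independent of \<open>x\<close>,
  the integral of \<open>h(cos 2\<theta>;1) / h(cos \<theta>;a,b,c,x)\<close>. Inserting this on the right-hand side and exchanging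
  the two integrations leaves the Jackson integral of \<open>(qx/u,qx/v,\<alpha>dx;q)\<^sub>\<infinity> / (sx,tx,dx;q)\<^sub>\<infinity>\<close> with
  \<open>s = e\<^sup>i\<^sup>\<theta>\<close>, \<open>t = 1/s\<close>. There the quotient \<open>(\<alpha>dx;q)\<^sub>\<infinity> / (dx;q)\<^sub>\<infinity>\<close> is expanded by the \<open>q\<close>-Gauss sum in the
  polynomials \<open>\<Prod>k<n. x - v q\<^sup>k\<close>, whose Jackson integrals satisfy a two-term recurrence starting at the
  Andrews--Askey integral; the result is the \<open>\<^sub>3\<phi>\<^sub>2\<close>.

  All the evaluations used (\<open>q\<close>-Gauss, Andrews--Askey, Askey--Wilson) come from a first order
  \<open>q\<close>-difference equation in one parameter, iterated down to the value 0 of that parameter.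
\<close>

section \<open>The infinite q-shifted factorial\<close>

text \<open>The expansion polynomials have their roots at the lattice points
  \<open>v * q ^ k\<close>. This makes consecutive Jackson integrals differ by one elementary
  factor, and these factors supply what separates the 2phi1 of the q-Gauss sum from the 3phi2: the
  upper parameters \<open>s * v\<close>, \<open>t * v\<close>, the lower parameter
  \<open>s * t * u * v = u * v\<close> and the power \<open>u ^ n\<close>.

  A q-difference equation fixes a quantity only up to its value at parameter 0. That constant is
  recovered by reading the reduction backwards from a point where everything is elementary:
  \<open>x = v\<close> for q-Gauss, an integrand equal to 1 for Andrews-Askey, a trigonometric
  polynomial for Askey-Wilson.

  For Jackson integrals the equation comes from telescoping along the lattice. A circle integral has
  no such lattice; there the contour is moved from \<open>|z| = 1\<close> to
  \<open>|z| = |q|\<close>.\<close>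

lemma norm_mult_lt_1:
  assumes "norm (a :: complex) < 1" "norm b < 1"
  shows "norm (a * b) < 1"
  using norm_mult_less[OF assms] by simp

context
  fixes q :: complex
  assumes q: "norm q < 1"
begin

text \<open>On a disc the deviations of the factors from 1 are dominated by the geometric series
  \<open>r * norm q ^ n\<close>. Uniformity in \<open>a\<close> is wanted for holomorphy in the
  argument, on which the contour shift for the Askey-Wilson integral rests.\<close>

lemma qpoch_inf_uniform_limit:
  "uniform_limit (cball 0 r) (\<lambda>n a. qpoch a q n) (\<lambda>a. qpoch_inf a q) sequentially"
proof -
  have "uniformly_convergent_on (cball 0 r) (\<lambda>N (a::complex). \<Prod>n<N. 1 + - (a * q ^ n))"
  proof (rule uniformly_convergent_on_prod)
    show "uniformly_convergent_on (cball 0 r) (\<lambda>N (a::complex). \<Sum>n<N. norm (- (a * q ^ n)))"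
    proof (rule Weierstrass_m_test')
      show "summable (\<lambda>n. r * norm q ^ n)"
        using q by (intro summable_mult summable_geometric) auto
    qed (auto simp: norm_mult norm_power intro!: mult_right_mono)
  qed (auto intro!: continuous_intros)
  then have "uniformly_convergent_on (cball 0 r) (\<lambda>n a. qpoch a q n)"
    by (simp add: qpoch_def)
  moreover have "lim (\<lambda>n. qpoch a q n) = qpoch_inf a q" for a
  proof -
    have "abs_convergent_prod (\<lambda>k. 1 - a * q ^ k)"
    proof (rule summable_imp_abs_convergent_prod)
      show "summable (\<lambda>k. norm (1 - a * q ^ k - 1))"
        using q by (auto simp: norm_mult norm_power intro!: summable_mult summable_geometric)
    qed
    then have "(\<lambda>n. \<Prod>k\<le>n. 1 - a * q ^ k) \<longlonglongrightarrow> qpoch_inf a q"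
      unfolding qpoch_inf_def
      by (intro convergent_prod_LIMSEQ abs_convergent_prod_imp_convergent_prod)
    then have "(\<lambda>n. qpoch a q (Suc n)) \<longlonglongrightarrow> qpoch_inf a q"
      by (simp only: qpoch_def lessThan_Suc_atMost)
    then have "(\<lambda>n. qpoch a q n) \<longlonglongrightarrow> qpoch_inf a q"
      by (rule LIMSEQ_imp_Suc)
    then show ?thesis by (rule limI)
  qed
  ultimately show ?thesis
    by (simp add: uniformly_convergent_uniform_limit_iff)
qed

lemma qpoch_LIMSEQ: "(\<lambda>n. qpoch a q n) \<longlonglongrightarrow> qpoch_inf a q"
  by (rule tendsto_uniform_limitI[OF qpoch_inf_uniform_limit[of "norm a"]]) simp

lemma qpoch_inf_holomorphic_UNIV: "(\<lambda>a. qpoch_inf a q) holomorphic_on UNIV"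
proof (rule holomorphic_uniform_sequence[of UNIV "\<lambda>n a. qpoch a q n"])
  fix x :: complex
  have "cball x 1 \<subseteq> cball 0 (norm x + 1)"
    by (simp add: cball_subset_cball_iff)
  then show "\<exists>d>0. cball x d \<subseteq> UNIV \<and>
      uniform_limit (cball x d) (\<lambda>n a. qpoch a q n) (\<lambda>a. qpoch_inf a q) sequentially"
    using uniform_limit_on_subset[OF qpoch_inf_uniform_limit] by (intro exI[of _ 1]) auto
qed (auto simp: qpoch_def intro!: holomorphic_intros)

lemma qpoch_inf_holomorphic [holomorphic_intros]:
  assumes "f holomorphic_on S"
  shows "(\<lambda>z. qpoch_inf (f z) q) holomorphic_on S"
  using holomorphic_on_compose[OF assms holomorphic_on_subset[OF qpoch_inf_holomorphic_UNIV]]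
  by (simp add: o_def)

lemma qpoch_inf_continuous [continuous_intros]:
  assumes "continuous_on S f"
  shows "continuous_on S (\<lambda>z. qpoch_inf (f z) q)"
  using continuous_on_compose2[OF holomorphic_on_imp_continuous_on[OF qpoch_inf_holomorphic_UNIV] assms]
  by simp

lemma qpoch_inf_tendsto [tendsto_intros]:
  assumes "(f \<longlongrightarrow> l) F"
  shows "((\<lambda>z. qpoch_inf (f z) q) \<longlongrightarrow> qpoch_inf l q) F"
proof -
  have "isCont (\<lambda>a. qpoch_inf a q) l"
    using holomorphic_on_imp_continuous_on[OF qpoch_inf_holomorphic_UNIV]
    by (simp add: continuous_on_eq_continuous_at)
  then show ?thesis using assms by (rule isCont_tendsto_compose)
qed

lemma qpoch_add: "qpoch a q (n + m) = qpoch a q n * qpoch (a * q ^ n) q m"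
  by (induction m) (simp_all add: qpoch_def power_add mult_ac)

lemma qpoch_inf_split: "qpoch_inf a q = qpoch a q n * qpoch_inf (a * q ^ n) q"
proof (rule LIMSEQ_unique)
  show "(\<lambda>m. qpoch a q (n + m)) \<longlonglongrightarrow> qpoch_inf a q"
    using LIMSEQ_ignore_initial_segment[OF qpoch_LIMSEQ, of a n] by (simp add: add.commute)
  show "(\<lambda>m. qpoch a q (n + m)) \<longlonglongrightarrow> qpoch a q n * qpoch_inf (a * q ^ n) q"
    unfolding qpoch_add by (intro tendsto_intros qpoch_LIMSEQ)
qed

text \<open>The source of the q-difference equations below: multiplying a parameter by
  \<open>q\<close> removes one linear factor.\<close>

lemma qpoch_inf_rec: "qpoch_inf a q = (1 - a) * qpoch_inf (q * a) q"
  using qpoch_inf_split[of a 1] by (simp add: qpoch_def mult.commute)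

lemma qpoch_inf_0 [simp]: "qpoch_inf 0 q = 1"
  by (simp add: qpoch_inf_def)

lemma qpoch_inf_nonzero:
  assumes "\<And>n. a * q ^ n \<noteq> 1"
  shows "qpoch_inf a q \<noteq> 0"
  unfolding qpoch_inf_def
proof (rule prodinf_nonzero)
  show "convergent_prod (\<lambda>k. 1 - a * q ^ k)"
  proof (intro abs_convergent_prod_imp_convergent_prod summable_imp_abs_convergent_prod)
    show "summable (\<lambda>k. norm (1 - a * q ^ k - 1))"
      using q by (auto simp: norm_mult norm_power intro!: summable_mult summable_geometric)
  qed
  show "1 - a * q ^ k \<noteq> 0" for k using assms[of k] by simp
qed

lemma norm_mult_power_lt_1:
  assumes "norm (a::complex) < 1"
  shows "norm (a * q ^ n) < 1"
proof -
  have "norm q ^ n \<le> 1" using q by (simp add: power_le_one)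
  then show ?thesis using assms
    by (simp add: norm_mult norm_power) (metis mult_left_le norm_ge_zero order_le_less_trans)
qed

lemma qpoch_inf_nonzero_norm:
  assumes "norm a < 1"
  shows "qpoch_inf a q \<noteq> 0"
  by (rule qpoch_inf_nonzero) (metis assms norm_mult_power_lt_1 norm_one order_less_irrefl)

lemma qpoch_0 [simp]: "qpoch a q 0 = 1"
  by (simp add: qpoch_def)

lemma qpoch_Suc: "qpoch a q (Suc n) = qpoch a q n * (1 - a * q ^ n)"
  by (simp add: qpoch_def)

lemma qpoch_nonzero:
  assumes "\<And>n. a * q ^ n \<noteq> 1"
  shows "qpoch a q n \<noteq> 0"
  using assms by (auto simp: qpoch_def)

lemma power_q_tendsto_0: "(\<lambda>n. s * q ^ n) \<longlonglongrightarrow> 0"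
  using tendsto_mult_right_zero[OF LIMSEQ_power_zero[OF q], of s] by simp

text \<open>Iterating \<open>X s = B s * X (q * s)\<close> and the same relation for \<open>\<psi>\<close> gives
  \<open>X s * \<psi> (s * q ^ n) = \<psi> s * X (s * q ^ n)\<close>, without dividing by a possibly vanishing factor.\<close>

lemma q_iterate:
  fixes X \<psi> B :: "complex \<Rightarrow> complex"
  assumes X: "\<And>n. X (s * q ^ n) = B (s * q ^ n) * X (q * (s * q ^ n))"
    and \<psi>: "\<And>n. \<psi> (s * q ^ n) = B (s * q ^ n) * \<psi> (q * (s * q ^ n))"
    and X0: "(\<lambda>n. X (s * q ^ n)) \<longlonglongrightarrow> X 0"
    and \<psi>0: "(\<lambda>n. \<psi> (s * q ^ n)) \<longlonglongrightarrow> \<psi> 0"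
  shows "X s * \<psi> 0 = \<psi> s * X 0"
proof -
  define b where "b n = (\<Prod>k<n. B (s * q ^ k))" for n
  have XX: "X s = b n * X (s * q ^ n)" for n
  proof (induction n)
    case (Suc n)
    then show ?case using X[of n] by (simp add: b_def mult_ac)
  qed (simp add: b_def)
  have PP: "\<psi> s = b n * \<psi> (s * q ^ n)" for n
  proof (induction n)
    case (Suc n)
    then show ?case using \<psi>[of n] by (simp add: b_def mult_ac)
  qed (simp add: b_def)
  have "X s * \<psi> (s * q ^ n) = \<psi> s * X (s * q ^ n)" for n
    by (subst XX[of n], subst PP[of n]) simp
  moreover have "(\<lambda>n. X s * \<psi> (s * q ^ n)) \<longlonglongrightarrow> X s * \<psi> 0"
    and "(\<lambda>n. \<psi> s * X (s * q ^ n)) \<longlonglongrightarrow> \<psi> s * X 0"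
    by (intro tendsto_intros X0 \<psi>0)+
  ultimately show ?thesis using LIMSEQ_unique by simp
qed

lemma qpoch_bounded: "\<exists>K>0. \<forall>n. norm (qpoch a q n) \<le> K"
  using qpoch_LIMSEQ[of a, THEN convergentI, THEN convergent_imp_Bseq] by (auto simp: Bseq_def)

lemma inverse_qpoch_bounded:
  assumes "\<And>n. a * q ^ n \<noteq> 1"
  shows "\<exists>K>0. \<forall>n. norm (inverse (qpoch a q n)) \<le> K"
  using tendsto_inverse[OF qpoch_LIMSEQ qpoch_inf_nonzero[OF assms], THEN convergentI, THEN convergent_imp_Bseq]
  by (auto simp: Bseq_def)

end

text \<open>The factors pair as \<open>(1 - a q^k) (1 + a q^k) = 1 - a^2 q^(2k)\<close>. Together
  with the splitting into even and odd indices this serves the evaluation of the Askey-Wilson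
  integral at \<open>q, -q, s, -s\<close>.\<close>

lemma qpoch_inf_mult_uminus:
  assumes q: "norm q < 1"
  shows "qpoch_inf a q * qpoch_inf (- a) q = qpoch_inf (a\<^sup>2) (q\<^sup>2)"
proof (rule LIMSEQ_unique)
  have q2: "norm (q\<^sup>2) < 1" using q by (simp add: norm_power power_less_one_iff abs_square_less_1)
  show "(\<lambda>n. qpoch a q n * qpoch (- a) q n) \<longlonglongrightarrow> qpoch_inf a q * qpoch_inf (- a) q"
    by (intro tendsto_intros qpoch_LIMSEQ q)
  have "qpoch a q n * qpoch (- a) q n = qpoch (a\<^sup>2) (q\<^sup>2) n" for n
    by (simp add: qpoch_def prod.distrib[symmetric] power2_eq_square algebra_simps power_mult_distrib)
  then show "(\<lambda>n. qpoch a q n * qpoch (- a) q n) \<longlonglongrightarrow> qpoch_inf (a\<^sup>2) (q\<^sup>2)"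
    by (simp add: qpoch_LIMSEQ q2)
qed

lemma qpoch_inf_even_odd:
  assumes q: "norm q < 1"
  shows "qpoch_inf a q = qpoch_inf a (q\<^sup>2) * qpoch_inf (q * a) (q\<^sup>2)"
proof (rule LIMSEQ_unique)
  have q2: "norm (q\<^sup>2) < 1" using q by (simp add: norm_power power_less_one_iff abs_square_less_1)
  show "(\<lambda>n. qpoch a q (2 * n)) \<longlonglongrightarrow> qpoch_inf a q"
    by (rule LIMSEQ_subseq_LIMSEQ[OF qpoch_LIMSEQ[OF q], unfolded o_def]) (auto simp: strict_mono_def)
  have "qpoch a q (2 * n) = qpoch a (q\<^sup>2) n * qpoch (q * a) (q\<^sup>2) n" for n
    by (induction n) (simp_all add: qpoch_def mult_ac flip: power_mult)
  then show "(\<lambda>n. qpoch a q (2 * n)) \<longlonglongrightarrow> qpoch_inf a (q\<^sup>2) * qpoch_inf (q * a) (q\<^sup>2)"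
    by (auto intro!: tendsto_intros qpoch_LIMSEQ q2)
qed

section \<open>The q-Gauss sum\<close>

text \<open>The coefficient of \<open>(v/x;q)_n x^n\<close> in the 2phi1 with upper parameters
  \<open>A = \<alpha>\<close>, \<open>B = v/x\<close>, lower parameter
  \<open>C = \<alpha> d v\<close> and argument \<open>d x\<close>. That argument is
  \<open>C/(A B)\<close>, the one at which the q-Gauss sum has a product value.\<close>

definition gauss_coeff :: "complex \<Rightarrow> complex \<Rightarrow> complex \<Rightarrow> complex \<Rightarrow> nat \<Rightarrow> complex" where
  "gauss_coeff q \<alpha> d v n = qpoch \<alpha> q n * d ^ n / (qpoch q q n * qpoch (\<alpha> * d * v) q n)"

text \<open>The product is \<open>(v/x;q)\<^sub>n x\<^sup>n\<close> in a form that remains meaningful for \<open>x = 0\<close>, hence also on the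
  lattice points \<open>u q\<^sup>n\<close> when \<open>q = 0\<close>.\<close>

definition gauss_sum :: "complex \<Rightarrow> complex \<Rightarrow> complex \<Rightarrow> complex \<Rightarrow> complex \<Rightarrow> complex" where
  "gauss_sum q \<alpha> d v x = (\<Sum>n. gauss_coeff q \<alpha> d v n * (\<Prod>k<n. x - v * q ^ k))"

text \<open>Apart from the factor with index 0, the factor with index \<open>k + 1\<close> is
  \<open>q\<close> times \<open>x - v * q ^ k\<close>: dilating \<open>x\<close> by \<open>q\<close>
  shifts the roots by one place.\<close>

lemma prod_shift_mult_q:
  fixes q v x :: complex
  shows "(\<Prod>k<Suc n. q * x - v * q ^ k) = (q * x - v) * q ^ n * (\<Prod>k<n. x - v * q ^ k)"
proof -
  have "(\<Prod>k<Suc n. q * x - v * q ^ k) = (q * x - v) * (\<Prod>k<n. q * x - v * q ^ Suc k)"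
    by (subst prod.lessThan_Suc_shift) simp
  also have "(\<Prod>k<n. q * x - v * q ^ Suc k) = (\<Prod>k<n. q * (x - v * q ^ k))"
    by (simp add: algebra_simps)
  also have "\<dots> = q ^ n * (\<Prod>k<n. x - v * q ^ k)"
    by (simp add: prod.distrib)
  finally show ?thesis by simp
qed

context
  fixes q :: complex
  assumes q: "norm q < 1"
begin

text \<open>The factor with index \<open>k\<close> has norm at most \<open>1 + norm q ^ k\<close>,
  and the product of these bounds is \<open>(-1;|q|)_n\<close>, a convergent sequence. The bound is
  therefore uniform in \<open>n\<close> and \<open>x\<close> at once.\<close>

lemma prod_shift_bounded:
  assumes "norm (v::complex) \<le> 1"
  shows "\<exists>K>0. \<forall>n x. norm x \<le> 1 \<longrightarrow> norm (\<Prod>k<n. x - v * q ^ k) \<le> K"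
proof -
  define r where "r = complex_of_real (norm q)"
  have r: "norm r < 1" using q by (simp add: r_def)
  obtain K where K: "K > 0" "\<And>n. norm (qpoch (-1) r n) \<le> K"
    using qpoch_bounded[OF r] by metis
  have "norm (\<Prod>k<n. x - v * q ^ k) \<le> K" if x: "norm x \<le> 1" for n and x :: complex
  proof -
    have "norm (\<Prod>k<n. x - v * q ^ k) \<le> (\<Prod>k<n. 1 + norm q ^ k)"
      unfolding prod_norm[symmetric]
    proof (intro prod_mono conjI)
      fix k
      have "norm (v * q ^ k) \<le> 1 * norm q ^ k"
        unfolding norm_mult norm_power using assms by (intro mult_right_mono) auto
      then show "norm (x - v * q ^ k) \<le> 1 + norm q ^ k"
        using x norm_triangle_ineq4[of x "v * q ^ k"] by linarith
    qed auto
    also have "\<dots> = norm (complex_of_real (\<Prod>k<n. 1 + norm q ^ k))"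
      unfolding norm_of_real by (simp add: prod_nonneg)
    also have "complex_of_real (\<Prod>k<n. 1 + norm q ^ k) = qpoch (-1) r n"
      by (simp add: qpoch_def r_def)
    finally show ?thesis using K(2)[of n] by linarith
  qed
  with K(1) show ?thesis by blast
qed

lemma q_power_neq_1: "q * q ^ n \<noteq> 1"
  using norm_mult_power_lt_1[OF q q, of n] by force

context
  fixes \<alpha> d v :: complex
  assumes d: "norm d < 1" and v: "norm v < 1"
    and nz: "\<And>n. \<alpha> * d * v * q ^ n \<noteq> 1"
begin

lemma gauss_coeff_Suc:
  "(1 - q ^ Suc n) * (1 - \<alpha> * d * v * q ^ n) * gauss_coeff q \<alpha> d v (Suc n)
     = d * (1 - \<alpha> * q ^ n) * gauss_coeff q \<alpha> d v n"
proof -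
  define X Y E F where "X = qpoch q q n" and "Y = qpoch (\<alpha> * d * v) q n"
    and "E = 1 - q * q ^ n" and "F = 1 - \<alpha> * d * v * q ^ n"
  have nz': "X \<noteq> 0" "Y \<noteq> 0" "E \<noteq> 0" "F \<noteq> 0"
    using qpoch_nonzero[OF q q_power_neq_1] qpoch_nonzero[OF q nz] q_power_neq_1[of n] nz[of n]
    by (auto simp: X_def Y_def E_def F_def)
  have "gauss_coeff q \<alpha> d v (Suc n) =
      qpoch \<alpha> q n * (1 - \<alpha> * q ^ n) * (d * d ^ n) / ((X * E) * (Y * F))"
    by (simp add: gauss_coeff_def qpoch_Suc[OF q] X_def Y_def E_def F_def)
  then have "E * F * gauss_coeff q \<alpha> d v (Suc n) = d * (1 - \<alpha> * q ^ n) * (qpoch \<alpha> q n * d ^ n / (X * Y))"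
    using nz' by simp
  then show ?thesis by (simp add: gauss_coeff_def X_def Y_def E_def F_def)
qed

text \<open>All factors except \<open>d ^ n\<close> stay bounded, the reciprocals because the finite
  products neither vanish nor tend to 0. The geometric majorant holds on the whole unit disc, hence
  on both lattices; it gives continuity at 0 and the exchange with the Jackson integral.\<close>

lemma gauss_term_bounded:
  "\<exists>K>0. \<forall>n x. norm x \<le> 1 \<longrightarrow>
     norm (gauss_coeff q \<alpha> d v n * (\<Prod>k<n. x - v * q ^ k)) \<le> K * norm d ^ n"
proof -
  obtain K1 where K1: "K1 > 0" "\<And>n. norm (qpoch \<alpha> q n) \<le> K1"
    using qpoch_bounded[OF q] by metis
  obtain K2 where K2: "K2 > 0" "\<And>n. norm (inverse (qpoch q q n)) \<le> K2"
    using inverse_qpoch_bounded[OF q, of q] q_power_neq_1 by metis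
  obtain K3 where K3: "K3 > 0" "\<And>n. norm (inverse (qpoch (\<alpha> * d * v) q n)) \<le> K3"
    using inverse_qpoch_bounded[OF q nz] by metis
  obtain K4 where K4: "K4 > 0" "\<And>n x. norm x \<le> 1 \<Longrightarrow> norm (\<Prod>k<n. x - v * q ^ k) \<le> K4"
    using prod_shift_bounded[of v] v by (metis less_imp_le)
  have "norm (gauss_coeff q \<alpha> d v n * (\<Prod>k<n. x - v * q ^ k)) \<le> (K1 * K2 * K3 * K4) * norm d ^ n"
    if "norm x \<le> 1" for n x
  proof -
    have "norm (gauss_coeff q \<alpha> d v n * (\<Prod>k<n. x - v * q ^ k)) =
        (norm (qpoch \<alpha> q n) * norm (inverse (qpoch q q n)) * norm (inverse (qpoch (\<alpha> * d * v) q n))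
          * norm (\<Prod>k<n. x - v * q ^ k)) * norm d ^ n"
      by (simp add: gauss_coeff_def norm_mult norm_divide norm_power norm_inverse field_simps)
    also have "\<dots> \<le> (K1 * K2 * K3 * K4) * norm d ^ n"
      using K1 K2 K3 K4(1) K4(2)[OF that] by (intro mult_right_mono mult_mono) (auto intro: less_imp_le)
    finally show ?thesis .
  qed
  moreover have "K1 * K2 * K3 * K4 > 0" using K1 K2 K3 K4 by simp
  ultimately show ?thesis by blast
qed

lemma gauss_uniform_limit:
  "uniform_limit (cball 0 1) (\<lambda>N x. \<Sum>n<N. gauss_coeff q \<alpha> d v n * (\<Prod>k<n. x - v * q ^ k))
     (gauss_sum q \<alpha> d v) sequentially"
proof -
  obtain K where K: "\<And>n x. norm x \<le> 1 \<Longrightarrow>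
      norm (gauss_coeff q \<alpha> d v n * (\<Prod>k<n. x - v * q ^ k)) \<le> K * norm d ^ n"
    using gauss_term_bounded by metis
  show ?thesis unfolding gauss_sum_def
  proof (rule Weierstrass_m_test)
    show "summable (\<lambda>n. K * norm d ^ n)"
      using d by (intro summable_mult summable_geometric) auto
  qed (use K in auto)
qed

lemma gauss_sums:
  assumes "norm x \<le> 1"
  shows "(\<lambda>n. gauss_coeff q \<alpha> d v n * (\<Prod>k<n. x - v * q ^ k)) sums gauss_sum q \<alpha> d v x"
  unfolding sums_def by (rule tendsto_uniform_limitI[OF gauss_uniform_limit]) (use assms in simp)

lemma gauss_sum_continuous: "continuous_on (cball 0 1) (gauss_sum q \<alpha> d v)"
  by (rule uniform_limit_theorem[OF _ gauss_uniform_limit])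
     (auto intro!: always_eventually continuous_intros)

lemma gauss_sum_self: "gauss_sum q \<alpha> d v v = 1"
proof -
  have "gauss_coeff q \<alpha> d v n * (\<Prod>k<n. v - v * q ^ k) = (if n = 0 then 1 else 0)" for n
    by (auto simp: gauss_coeff_def qpoch_0[OF q] intro!: bexI[of _ 0])
  then show ?thesis using sums_single[of 0 "\<lambda>_. 1 :: complex"] by (simp add: gauss_sum_def sums_iff)
qed

text \<open>The difference of the two sides telescopes termwise.\<close>

lemma gauss_sum_functional_equation:
  assumes x: "norm x \<le> 1"
  shows "(1 - d * x) * gauss_sum q \<alpha> d v x = (1 - \<alpha> * d * x) * gauss_sum q \<alpha> d v (q * x)"
proof -
  define c where "c = gauss_coeff q \<alpha> d v"
  define p where "p n y = (\<Prod>k<n. y - v * q ^ k)" for n and y :: complex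
  \<comment> \<open>\<open>H n\<close> is the defect in
    \<open>c n * p n (q * x) = q ^ n * (c n * p n x) - H n\<close>. The recursion of the
    coefficients turns it into a multiple of the term with index \<open>n - 1\<close>, whence the
    case distinction and the value 0 at the start.\<close>
  define H where "H n = (case n of 0 \<Rightarrow> 0 | Suc m \<Rightarrow>
      v * q ^ m * (1 - \<alpha> * q ^ m) * d / (1 - \<alpha> * d * v * q ^ m) * (c m * p m x))" for n
  \<comment> \<open>The antidifference of the summands. It is 0 at \<open>n = 0\<close>, where
    \<open>1 - q ^ n\<close> and \<open>H\<close> both vanish, and tends to 0 with the terms of the
    series, so the telescoped sum is 0.\<close>
  define U where "U n = (1 - q ^ n) * (c n * p n x) + (1 - \<alpha> * d * x) * H n" for n
  have qx: "norm (q * x) \<le> 1"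
    using q x by (simp add: norm_mult mult_le_one)
  have S: "(\<lambda>n. c n * p n x) sums gauss_sum q \<alpha> d v x" "(\<lambda>n. c n * p n (q * x)) sums gauss_sum q \<alpha> d v (q * x)"
    using gauss_sums[OF x] gauss_sums[OF qx] by (simp_all add: c_def p_def)
  have pS: "p (Suc n) x = (x - v * q ^ n) * p n x" for n
    by (simp add: p_def)
  have step: "(1 - d * x) * (c n * p n x) - (1 - \<alpha> * d * x) * (c n * p n (q * x)) = U n - U (Suc n)" for n
  proof -
    have nzn: "1 - \<alpha> * d * v * q ^ n \<noteq> 0" using nz[of n] by simp
    have cS: "(1 - q ^ Suc n) * c (Suc n) = d * (1 - \<alpha> * q ^ n) * c n / (1 - \<alpha> * d * v * q ^ n)"
      using gauss_coeff_Suc[of n] nzn unfolding c_def by (simp add: field_simps)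
    have HS: "c n * p n (q * x) = q ^ n * (c n * p n x) - H n"
    proof (cases n)
      case (Suc m)
      have nzm: "1 - \<alpha> * d * v * q ^ m \<noteq> 0" using nz[of m] by simp
      have pe: "p (Suc m) (q * x) = q ^ Suc m * p (Suc m) x - v * q ^ m * (1 - q ^ Suc m) * p m x"
        unfolding pS unfolding p_def prod_shift_mult_q by (simp add: algebra_simps)
      have "c (Suc m) * p (Suc m) (q * x) = q ^ Suc m * (c (Suc m) * p (Suc m) x)
          - v * q ^ m * p m x * ((1 - q ^ Suc m) * c (Suc m))"
        unfolding pe by (simp add: algebra_simps)
      also have "(1 - q ^ Suc m) * c (Suc m) = d * (1 - \<alpha> * q ^ m) * c m / (1 - \<alpha> * d * v * q ^ m)"
        using gauss_coeff_Suc[of m] nzm unfolding c_def by (simp add: field_simps)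
      finally show ?thesis by (simp add: H_def Suc)
    qed (simp add: H_def p_def)
    have "U n - U (Suc n) = (1 - q ^ n) * (c n * p n x) + (1 - \<alpha> * d * x) * H n
        - d * (1 - \<alpha> * q ^ n) / (1 - \<alpha> * d * v * q ^ n) * (x - v * q ^ n) * (c n * p n x)
        - (1 - \<alpha> * d * x) * (v * q ^ n * (1 - \<alpha> * q ^ n) * d / (1 - \<alpha> * d * v * q ^ n) * (c n * p n x))"
    proof -
      have "(1 - q ^ Suc n) * (c (Suc n) * p (Suc n) x) = ((1 - q ^ Suc n) * c (Suc n)) * ((x - v * q ^ n) * p n x)"
        by (simp add: pS)
      also have "\<dots> = d * (1 - \<alpha> * q ^ n) / (1 - \<alpha> * d * v * q ^ n) * (x - v * q ^ n) * (c n * p n x)"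
        unfolding cS by simp
      finally show ?thesis by (simp add: U_def H_def)
    qed
    also have "\<dots> = (1 - d * x) * (c n * p n x) - (1 - \<alpha> * d * x) * (q ^ n * (c n * p n x) - H n)"
    proof -
      define Q where "Q = q ^ n"
      define A where "A = c n * p n x"
      show ?thesis using nzn unfolding Q_def[symmetric] A_def[symmetric]
        by (simp add: divide_simps) (simp add: algebra_simps)
    qed
    also have "\<dots> = (1 - d * x) * (c n * p n x) - (1 - \<alpha> * d * x) * (c n * p n (q * x))"
      by (simp add: HS)
    finally show ?thesis by simp
  qed
  have A0: "(\<lambda>n. c n * p n x) \<longlonglongrightarrow> 0"
    using S(1) by (rule summable_LIMSEQ_zero[OF sums_summable])
  have q0: "(\<lambda>n. q ^ n) \<longlonglongrightarrow> 0" by (rule LIMSEQ_power_zero[OF q])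
  have "(\<lambda>m. H (Suc m)) \<longlonglongrightarrow> v * 0 * (1 - \<alpha> * 0) * d / (1 - \<alpha> * d * v * 0) * 0"
    unfolding H_def nat.case by (intro tendsto_intros q0 A0) auto
  then have "H \<longlonglongrightarrow> 0" by (simp add: filterlim_sequentially_Suc)
  then have "U \<longlonglongrightarrow> (1 - 0) * 0 + (1 - \<alpha> * d * x) * 0"
    unfolding U_def by (intro tendsto_intros q0 A0)
  then have "(\<lambda>n. U n - U (Suc n)) sums (U 0 - 0)"
    by (intro telescope_sums') simp
  then have "(\<lambda>n. (1 - d * x) * (c n * p n x) - (1 - \<alpha> * d * x) * (c n * p n (q * x))) sums 0"
    unfolding step by (simp add: U_def H_def)
  moreover have "(\<lambda>n. (1 - d * x) * (c n * p n x) - (1 - \<alpha> * d * x) * (c n * p n (q * x))) sums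
      ((1 - d * x) * gauss_sum q \<alpha> d v x - (1 - \<alpha> * d * x) * gauss_sum q \<alpha> d v (q * x))"
    by (intro sums_diff sums_mult S)
  ultimately show ?thesis using sums_unique2 by fastforce
qed

text \<open>The product \<open>(d x;q)_inf\<close> absorbs the factor \<open>1 - d * x\<close> of
  the functional equation, after which both sides obey the recursion with factor
  \<open>1 - \<alpha> * d * x\<close>. As \<alpha> is arbitrary this factor may vanish, hence
  \<open>q_iterate\<close>.\<close>

lemma q_gauss_at_0:
  assumes x: "norm x \<le> 1"
  shows "qpoch_inf (d * x) q * gauss_sum q \<alpha> d v x = qpoch_inf (\<alpha> * d * x) q * gauss_sum q \<alpha> d v 0"
proof -
  have xn: "norm (x * q ^ n) \<le> 1" for n
    using q x by (simp add: norm_mult norm_power mult_le_one power_le_one)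
  have "(qpoch_inf (d * x) q * gauss_sum q \<alpha> d v x) * qpoch_inf (\<alpha> * d * 0) q
      = qpoch_inf (\<alpha> * d * x) q * (qpoch_inf (d * 0) q * gauss_sum q \<alpha> d v 0)"
  proof (rule q_iterate[OF q, where B = "\<lambda>x. 1 - \<alpha> * d * x" and s = x
        and \<psi> = "\<lambda>x. qpoch_inf (\<alpha> * d * x) q" and X = "\<lambda>x. qpoch_inf (d * x) q * gauss_sum q \<alpha> d v x"])
    fix n
    define y where "y = x * q ^ n"
    show "qpoch_inf (d * y) q * gauss_sum q \<alpha> d v y =
        (1 - \<alpha> * d * y) * (qpoch_inf (d * (q * y)) q * gauss_sum q \<alpha> d v (q * y))"
      using gauss_sum_functional_equation[OF xn[of n, folded y_def]]
        qpoch_inf_rec[OF q, of "d * y"] by (simp add: mult_ac)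
    show "qpoch_inf (\<alpha> * d * y) q = (1 - \<alpha> * d * y) * qpoch_inf (\<alpha> * d * (q * y)) q"
      using qpoch_inf_rec[OF q, of "\<alpha> * d * y"] by (simp add: mult_ac)
  next
    have "isCont (gauss_sum q \<alpha> d v) 0"
      using continuous_on_interior[OF gauss_sum_continuous] by simp
    then have "(\<lambda>n. gauss_sum q \<alpha> d v (x * q ^ n)) \<longlonglongrightarrow> gauss_sum q \<alpha> d v 0"
      by (rule isCont_tendsto_compose) (rule power_q_tendsto_0[OF q])
    then show "(\<lambda>n. qpoch_inf (d * (x * q ^ n)) q * gauss_sum q \<alpha> d v (x * q ^ n)) \<longlonglongrightarrow> qpoch_inf (d * 0) q * gauss_sum q \<alpha> d v 0"
      by (intro tendsto_intros qpoch_inf_tendsto[OF q] power_q_tendsto_0[OF q])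
    show "(\<lambda>n. qpoch_inf (\<alpha> * d * (x * q ^ n)) q) \<longlonglongrightarrow> qpoch_inf (\<alpha> * d * 0) q"
      by (intro tendsto_intros qpoch_inf_tendsto[OF q] power_q_tendsto_0[OF q])
  qed
  then show ?thesis by (simp add: qpoch_inf_0[OF q])
qed

text \<open>The iteration leaves the value at 0 unknown. It is read off at \<open>x = v\<close>,
  where every product with \<open>n > 0\<close> contains the factor \<open>v - v\<close>.\<close>

lemma q_gauss:
  assumes x: "norm x \<le> 1"
  shows "qpoch_inf (\<alpha> * d * v) q * qpoch_inf (d * x) q * gauss_sum q \<alpha> d v x
    = qpoch_inf (\<alpha> * d * x) q * qpoch_inf (d * v) q"
proof -
  have "qpoch_inf (d * v) q = qpoch_inf (\<alpha> * d * v) q * gauss_sum q \<alpha> d v 0"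
    using q_gauss_at_0[of v] v by (simp add: gauss_sum_self)
  then show ?thesis using q_gauss_at_0[OF x] by (simp add: mult_ac)
qed

end

end

section \<open>Jackson integrals and the Andrews--Askey integral\<close>

lemma LIMSEQ_imp_norm_bounded:
  assumes "X \<longlonglongrightarrow> (l :: complex)"
  shows "\<exists>K>0. \<forall>n. norm (X n) \<le> K"
  using convergent_imp_Bseq[OF convergentI[OF assms]] by (simp add: Bseq_def)

definition jackson_summable :: "complex \<Rightarrow> complex \<Rightarrow> complex \<Rightarrow> (complex \<Rightarrow> complex) \<Rightarrow> bool" where
  "jackson_summable q a b g \<longleftrightarrow> summable (\<lambda>n. (b * g (b * q ^ n) - a * g (a * q ^ n)) * q ^ n)"

text \<open>The integrand of the Andrews-Askey integral. In the main argument \<open>s\<close> and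
  \<open>t\<close> are \<open>cis \<theta>\<close> and its inverse, and the denominator is then
  \<open>h(cos \<theta>;x)\<close>, the part of the Askey-Wilson weight that contains the fourth
  parameter \<open>x\<close>.\<close>

definition aa_weight :: "complex \<Rightarrow> complex \<Rightarrow> complex \<Rightarrow> complex \<Rightarrow> complex \<Rightarrow> complex \<Rightarrow> complex" where
  "aa_weight q u v s t x =
     qpoch_inf (q * x / u) q * qpoch_inf (q * x / v) q / (qpoch_inf (s * x) q * qpoch_inf (t * x) q)"

context
  fixes q :: complex
  assumes q: "norm q < 1"
begin

lemma jackson_summableI:
  assumes "(\<lambda>n. g (a * q ^ n)) \<longlonglongrightarrow> l" and "(\<lambda>n. g (b * q ^ n)) \<longlonglongrightarrow> l'"
  shows "jackson_summable q a b g"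
proof -
  have "(\<lambda>n. b * g (b * q ^ n) - a * g (a * q ^ n)) \<longlonglongrightarrow> b * l' - a * l"
    by (intro tendsto_intros assms)
  then obtain K where K: "\<And>n. norm (b * g (b * q ^ n) - a * g (a * q ^ n)) \<le> K"
    using LIMSEQ_imp_norm_bounded by meson
  show ?thesis unfolding jackson_summable_def
  proof (rule summable_comparison_test')
    show "summable (\<lambda>n. K * norm q ^ n)"
      using q by (intro summable_mult summable_geometric) auto
    show "norm ((b * g (b * q ^ n) - a * g (a * q ^ n)) * q ^ n) \<le> K * norm q ^ n" if "n \<ge> 0" for n
      unfolding norm_mult norm_power by (intro mult_right_mono K) auto
  qed
qed

lemma jackson_summable_linear:
  assumes "jackson_summable q a b f" "jackson_summable q a b g"
  shows "jackson_summable q a b (\<lambda>x. k * f x + l * g x)"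
proof -
  have "(b * (k * f (b * q ^ n) + l * g (b * q ^ n)) - a * (k * f (a * q ^ n) + l * g (a * q ^ n))) * q ^ n
      = k * ((b * f (b * q ^ n) - a * f (a * q ^ n)) * q ^ n) + l * ((b * g (b * q ^ n) - a * g (a * q ^ n)) * q ^ n)" for n
    by (simp add: algebra_simps)
  then show ?thesis
    using assms unfolding jackson_summable_def by (simp only: summable_add summable_mult)
qed

lemma jackson_integral_linear:
  assumes "jackson_summable q a b f" "jackson_summable q a b g"
  shows "jackson_integral q a b (\<lambda>x. k * f x + l * g x) = k * jackson_integral q a b f + l * jackson_integral q a b g"
proof -
  define F where "F n = (b * f (b * q ^ n) - a * f (a * q ^ n)) * q ^ n" for n
  define G where "G n = (b * g (b * q ^ n) - a * g (a * q ^ n)) * q ^ n" for n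
  have "summable F" using assms(1) unfolding jackson_summable_def F_def .
  moreover have "summable G" using assms(2) unfolding jackson_summable_def G_def .
  ultimately have "(\<Sum>n. k * F n + l * G n) = k * suminf F + l * suminf G"
    by (simp add: suminf_add[symmetric] summable_mult suminf_mult)
  moreover have "k * F n + l * G n = (b * (k * f (b * q ^ n) + l * g (b * q ^ n)) -
      a * (k * f (a * q ^ n) + l * g (a * q ^ n))) * q ^ n" for n
    by (simp add: F_def G_def algebra_simps)
  ultimately show ?thesis
    unfolding jackson_integral_def F_def[symmetric] G_def[symmetric] by (simp add: algebra_simps)
qed

lemma jackson_integral_cmult:
  assumes "jackson_summable q a b f"
  shows "jackson_integral q a b (\<lambda>x. k * f x) = k * jackson_integral q a b f"
  using jackson_integral_linear[OF assms assms, of k 0] by simp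

lemma jackson_integral_cong:
  assumes "\<And>n. f (a * q ^ n) = g (a * q ^ n)" "\<And>n. f (b * q ^ n) = g (b * q ^ n)"
  shows "jackson_integral q a b f = jackson_integral q a b g"
  by (simp add: jackson_integral_def assms)

text \<open>Both lattices run into 0, so the common limit \<open>l\<close> cancels between the two
  telescoping sums. Stated without division by the lattice point, the hypothesis also makes sense
  for \<open>q = 0\<close>, where these points are 0 from \<open>n = 1\<close> on.\<close>

lemma jackson_integral_q_diff:
  assumes "\<And>n. a * q ^ n * g (a * q ^ n) = f (a * q ^ n) - f (q * (a * q ^ n))"
    and "\<And>n. b * q ^ n * g (b * q ^ n) = f (b * q ^ n) - f (q * (b * q ^ n))"
    and "(\<lambda>n. f (a * q ^ n)) \<longlonglongrightarrow> l" and "(\<lambda>n. f (b * q ^ n)) \<longlonglongrightarrow> l"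
  shows "jackson_integral q a b g = (1 - q) * (f b - f a)"
proof -
  have "(\<lambda>n. (f (b * q ^ n) - f (b * q ^ Suc n)) - (f (a * q ^ n) - f (a * q ^ Suc n)))
      sums ((f (b * q ^ 0) - l) - (f (a * q ^ 0) - l))"
    by (intro sums_diff telescope_sums' assms)
  moreover have "(f (b * q ^ n) - f (b * q ^ Suc n)) - (f (a * q ^ n) - f (a * q ^ Suc n))
      = (b * g (b * q ^ n) - a * g (a * q ^ n)) * q ^ n" for n
    using assms(1)[of n] assms(2)[of n] by (simp add: algebra_simps)
  ultimately show ?thesis
    by (simp add: jackson_integral_def sums_iff)
qed

lemma jackson_integral_tendsto:
  assumes "\<And>k. (\<lambda>N. g N (a * q ^ k)) \<longlonglongrightarrow> h (a * q ^ k)"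
    and "\<And>k. (\<lambda>N. g N (b * q ^ k)) \<longlonglongrightarrow> h (b * q ^ k)"
    and "\<And>N k. norm (g N (a * q ^ k)) \<le> K" and "\<And>N k. norm (g N (b * q ^ k)) \<le> K"
  shows "(\<lambda>N::nat. jackson_integral q a b (g N)) \<longlonglongrightarrow> jackson_integral q a b h"
proof -
  let ?f = "\<lambda>k N. (b * g N (b * q ^ k) - a * g N (a * q ^ k)) * q ^ k"
  have "(\<lambda>N. suminf (\<lambda>k. ?f k N)) \<longlonglongrightarrow> (\<Sum>k. (b * h (b * q ^ k) - a * h (a * q ^ k)) * q ^ k)"
  proof (rule tannerys_theorem[THEN conjunct2, THEN conjunct2])
    show "(\<lambda>N. ?f k N) \<longlonglongrightarrow> (b * h (b * q ^ k) - a * h (a * q ^ k)) * q ^ k" for k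
      by (intro tendsto_intros assms)
    show "summable (\<lambda>k. (norm b * K + norm a * K) * norm q ^ k)"
      using q by (intro summable_mult summable_geometric) auto
    have "norm (?f k N) \<le> (norm b * K + norm a * K) * norm q ^ k" for k N
    proof -
      have "norm (b * g N (b * q ^ k) - a * g N (a * q ^ k)) \<le>
          norm (b * g N (b * q ^ k)) + norm (a * g N (a * q ^ k))"
        by (rule norm_triangle_ineq4)
      also have "\<dots> \<le> norm b * K + norm a * K"
        unfolding norm_mult by (intro add_mono mult_left_mono assms) auto
      finally show ?thesis unfolding norm_mult norm_power
        by (intro mult_right_mono) auto
    qed
    then show "\<forall>\<^sub>F (k, N) in at_top \<times>\<^sub>F sequentially.
        norm (?f k N) \<le> (norm b * K + norm a * K) * norm q ^ k"
      by (auto intro: always_eventually)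
  qed auto
  then show ?thesis unfolding jackson_integral_def by (intro tendsto_intros)
qed

lemma aa_weight_commute: "aa_weight q u v s t = aa_weight q u v t s"
  by (simp add: aa_weight_def fun_eq_iff mult_ac)

lemma aa_weight_tendsto: "(\<lambda>n. aa_weight q u v s t (w * q ^ n)) \<longlonglongrightarrow> 1"
proof -
  have "(\<lambda>n. aa_weight q u v s t (w * q ^ n)) \<longlonglongrightarrow>
      qpoch_inf (q * 0 / u) q * qpoch_inf (q * 0 / v) q / (qpoch_inf (s * 0) q * qpoch_inf (t * 0) q)"
    unfolding aa_weight_def divide_inverse
    by (intro tendsto_intros qpoch_inf_tendsto[OF q] power_q_tendsto_0[OF q]) (simp add: qpoch_inf_0[OF q])
  then show ?thesis by (simp add: qpoch_inf_0[OF q])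
qed

lemma aa_weight_summable: "jackson_summable q a b (aa_weight q u v s t)"
  by (rule jackson_summableI) (rule aa_weight_tendsto)+

lemma qpoch_inf_1: "qpoch_inf 1 q = 0"
  using qpoch_inf_rec[OF q, of 1] by simp

lemma lattice_nonzero:
  assumes "\<And>n. s * w * q ^ n \<noteq> 1"
  shows "qpoch_inf (s * (w * q ^ n)) q \<noteq> 0"
proof (rule qpoch_inf_nonzero[OF q])
  show "s * (w * q ^ n) * q ^ m \<noteq> 1" for m
    using assms[of "n + m"] by (simp add: power_add mult_ac)
qed

context
  fixes u v :: complex
  assumes u: "u \<noteq> 0" and v: "v \<noteq> 0"
begin

text \<open>The boundary function vanishes at both end points, so the integral of its \<open>q\<close>-derivative is 0.\<close>

lemma andrews_askey_recurrence:
  assumes su: "\<And>n. s * u * q ^ n \<noteq> 1" and sv: "\<And>n. s * v * q ^ n \<noteq> 1"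
    and tu: "\<And>n. t * u * q ^ n \<noteq> 1" and tv: "\<And>n. t * v * q ^ n \<noteq> 1"
  shows "(1 - s * u) * (1 - s * v) * jackson_integral q u v (aa_weight q u v s t) =
    (1 - s * t * u * v) * jackson_integral q u v (aa_weight q u v (q * s) t)"
proof -
  define f where "f x = s * u * v * (qpoch_inf (x / u) q * qpoch_inf (x / v) q /
      (qpoch_inf (s * x) q * qpoch_inf (t * x) q))" for x
  define g where "g x = ((1 - s * u) * (1 - s * v)) * aa_weight q u v s t x +
      (- (1 - s * t * u * v)) * aa_weight q u v (q * s) t x" for x
  have key: "x * g x = f x - f (q * x)"
    if "qpoch_inf (s * x) q \<noteq> 0" "qpoch_inf (t * x) q \<noteq> 0" for x
  proof -
    define A B S T where "A = qpoch_inf (q * x / u) q" and "B = qpoch_inf (q * x / v) q"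
      and "S = qpoch_inf (q * (s * x)) q" and "T = qpoch_inf (q * (t * x)) q"
    have r: "qpoch_inf (x / u) q = (1 - x / u) * A" "qpoch_inf (x / v) q = (1 - x / v) * B"
      "qpoch_inf (s * x) q = (1 - s * x) * S" "qpoch_inf (t * x) q = (1 - t * x) * T"
      using qpoch_inf_rec[OF q, of "x / u"] qpoch_inf_rec[OF q, of "x / v"]
        qpoch_inf_rec[OF q, of "s * x"] qpoch_inf_rec[OF q, of "t * x"]
      by (simp_all add: A_def B_def S_def T_def)
    have nz: "S \<noteq> 0" "T \<noteq> 0" "1 - s * x \<noteq> 0" "1 - t * x \<noteq> 0" using that r by auto
    have e: "s * (q * x) = q * (s * x)" "t * (q * x) = q * (t * x)" "q * s * x = q * (s * x)" by auto
    define K where "K = A * B / (S * T)"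
    have fx: "f x = s * u * v * (K * ((1 - x / u) * (1 - x / v) / ((1 - s * x) * (1 - t * x))))"
      unfolding f_def r K_def by (simp add: mult_ac)
    have fqx: "f (q * x) = s * u * v * K"
      unfolding f_def e K_def A_def B_def S_def T_def by simp
    have w1: "aa_weight q u v s t x = K / ((1 - s * x) * (1 - t * x))"
      unfolding aa_weight_def r K_def by (simp add: A_def B_def mult_ac)
    have w2: "aa_weight q u v (q * s) t x = K / (1 - t * x)"
      unfolding aa_weight_def e r K_def by (simp add: A_def B_def S_def mult_ac)
    have "x * ((1 - s * u) * (1 - s * v) / ((1 - s * x) * (1 - t * x))
        - (1 - s * t * u * v) / (1 - t * x)) = s * u * v *
        ((1 - x / u) * (1 - x / v) / ((1 - s * x) * (1 - t * x)) - 1)"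
    proof -
      define E F where "E = 1 - s * x" and "F = 1 - t * x"
      have EF: "E \<noteq> 0" "F \<noteq> 0" using nz by (simp_all add: E_def F_def)
      have "u * v * ((1 - x / u) * (1 - x / v)) = (u - x) * (v - x)"
        using u v by (simp add: field_simps)
      then have "s * u * v * ((1 - x / u) * (1 - x / v) / (E * F) - 1) = s * ((u - x) * (v - x) - u * v * (E * F)) / (E * F)"
        using EF by (simp add: field_simps)
      \<comment> \<open>The identity that makes \<open>f\<close> a q-primitive of \<open>g\<close>.
        The factor \<open>x\<close> splits off because \<open>(u - x) * (v - x)\<close> and
        \<open>u * v * (E * F)\<close> agree at \<open>x = 0\<close>.\<close>
      also have "s * ((u - x) * (v - x) - u * v * (E * F)) = x * ((1 - s * u) * (1 - s * v) - (1 - s * t * u * v) * E)"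
        unfolding E_def F_def by (simp add: algebra_simps)
      also have "\<dots> / (E * F) = x * ((1 - s * u) * (1 - s * v) / (E * F) - (1 - s * t * u * v) / F)"
        using EF by (simp add: field_simps)
      finally show ?thesis unfolding E_def F_def by simp
    qed
    then have mid: "K * (x * ((1 - s * u) * (1 - s * v) / ((1 - s * x) * (1 - t * x))
        - (1 - s * t * u * v) / (1 - t * x))) = K * (s * u * v *
        ((1 - x / u) * (1 - x / v) / ((1 - s * x) * (1 - t * x)) - 1))"
      by simp
    have "x * g x = K * (x * ((1 - s * u) * (1 - s * v) / ((1 - s * x) * (1 - t * x))
        - (1 - s * t * u * v) / (1 - t * x)))"
    proof -
      have "x * (a * (K / E) + - b * (K / F)) = K * (x * (a / E - b / F))" for a b E F
        by (simp add: divide_inverse algebra_simps)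
      then show ?thesis unfolding g_def w1 w2 .
    qed
    also note mid
    also have "K * (s * u * v *
        ((1 - x / u) * (1 - x / v) / ((1 - s * x) * (1 - t * x)) - 1)) = f x - f (q * x)"
      unfolding fx fqx by (simp add: right_diff_distrib mult_ac)
    finally show ?thesis .
  qed
  have lim: "(\<lambda>n. f (w * q ^ n)) \<longlonglongrightarrow> s * u * v" for w
  proof -
    have "(\<lambda>n. f (w * q ^ n)) \<longlonglongrightarrow> s * u * v * (qpoch_inf (0 / u) q * qpoch_inf (0 / v) q /
      (qpoch_inf (s * 0) q * qpoch_inf (t * 0) q))"
      unfolding f_def divide_inverse
      by (intro tendsto_intros qpoch_inf_tendsto[OF q] power_q_tendsto_0[OF q]) (simp add: qpoch_inf_0[OF q])
    then show ?thesis by (simp add: qpoch_inf_0[OF q])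
  qed
  have "jackson_integral q u v g = (1 - q) * (f v - f u)"
    by (rule jackson_integral_q_diff[OF key key lim lim])
       (use lattice_nonzero su sv tu tv in auto)
  moreover have "f u = 0" "f v = 0" using u v by (simp_all add: f_def qpoch_inf_1)
  moreover have "jackson_integral q u v g = ((1 - s * u) * (1 - s * v)) * jackson_integral q u v (aa_weight q u v s t) +
      (- (1 - s * t * u * v)) * jackson_integral q u v (aa_weight q u v (q * s) t)"
    unfolding g_def by (intro jackson_integral_linear aa_weight_summable)
  ultimately have "((1 - s * u) * (1 - s * v)) * jackson_integral q u v (aa_weight q u v s t) +
      (- (1 - s * t * u * v)) * jackson_integral q u v (aa_weight q u v (q * s) t) = 0"
    by simp
  then show ?thesis by (simp only: mult_minus_left add_uminus_conv_diff right_minus_eq)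
qed

text \<open>The two products in front absorb the factors on the left of the recurrence, so
  \<open>q_iterate\<close> runs with \<open>1 - s * t * u * v\<close> alone. The limit
  \<open>s -> 0\<close> is taken under the Jackson integral, for which the integrand has to be
  bounded uniformly in the iteration step and the lattice index.\<close>

lemma andrews_askey_reduce:
  assumes su: "\<And>n. s * u * q ^ n \<noteq> 1" and sv: "\<And>n. s * v * q ^ n \<noteq> 1"
    and tu: "\<And>n. t * u * q ^ n \<noteq> 1" and tv: "\<And>n. t * v * q ^ n \<noteq> 1"
  shows "qpoch_inf (s * u) q * qpoch_inf (s * v) q * jackson_integral q u v (aa_weight q u v s t) =
    qpoch_inf (s * t * u * v) q * jackson_integral q u v (aa_weight q u v 0 t)"
proof -
  let ?J = "\<lambda>s. jackson_integral q u v (aa_weight q u v s t)"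
  have shift: "s * q ^ n * w * q ^ m \<noteq> 1" if "\<And>n. s * w * q ^ n \<noteq> 1" for n m w
    using that[of "n + m"] by (simp add: power_add mult_ac)
  have "(qpoch_inf (s * u) q * qpoch_inf (s * v) q * ?J s) * qpoch_inf (0 * (t * u * v)) q =
      qpoch_inf (s * (t * u * v)) q * (qpoch_inf (0 * u) q * qpoch_inf (0 * v) q * ?J 0)"
  proof (rule q_iterate[OF q, where B = "\<lambda>s. 1 - s * t * u * v" and s = s
        and \<psi> = "\<lambda>s. qpoch_inf (s * (t * u * v)) q" and X = "\<lambda>s. qpoch_inf (s * u) q * qpoch_inf (s * v) q * ?J s"])
    fix n
    define y where "y = s * q ^ n"
    have "(1 - y * u) * (1 - y * v) * ?J y = (1 - y * t * u * v) * ?J (q * y)"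
      by (rule andrews_askey_recurrence) (use shift su sv tu tv in \<open>auto simp: y_def\<close>)
    then show "qpoch_inf (y * u) q * qpoch_inf (y * v) q * ?J y =
        (1 - y * t * u * v) * (qpoch_inf (q * y * u) q * qpoch_inf (q * y * v) q * ?J (q * y))"
      using qpoch_inf_rec[OF q, of "y * u"] qpoch_inf_rec[OF q, of "y * v"] by (simp add: mult_ac)
    show "qpoch_inf (y * (t * u * v)) q = (1 - y * t * u * v) * qpoch_inf (q * y * (t * u * v)) q"
      using qpoch_inf_rec[OF q, of "y * (t * u * v)"] by (simp add: mult_ac)
  next
    have pt: "(\<lambda>N. aa_weight q u v (s * q ^ N) t x) \<longlonglongrightarrow> aa_weight q u v 0 t x" for x
    proof -
      have "(\<lambda>N. qpoch_inf (s * q ^ N * x) q) \<longlonglongrightarrow> qpoch_inf (0 * x) q"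
        by (intro tendsto_intros qpoch_inf_tendsto[OF q] power_q_tendsto_0[OF q])
      then have "(\<lambda>N. aa_weight q u v 0 t x * inverse (qpoch_inf (s * q ^ N * x) q)) \<longlonglongrightarrow>
          aa_weight q u v 0 t x * inverse (qpoch_inf (0 * x) q)"
        by (intro tendsto_mult tendsto_const tendsto_inverse) (simp_all add: qpoch_inf_0[OF q])
      then show ?thesis by (simp add: aa_weight_def qpoch_inf_0[OF q] field_simps)
    qed
    have bd: "\<exists>K. \<forall>N k. norm (aa_weight q u v (s * q ^ N) t (w * q ^ k)) \<le> K" for w
    proof -
      obtain K1 where K1: "K1 > 0" "\<And>k. norm (aa_weight q u v 0 t (w * q ^ k)) \<le> K1"
        using LIMSEQ_imp_norm_bounded[OF aa_weight_tendsto[of u v 0 t w]] by blast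
      have "(\<lambda>n. inverse (qpoch_inf (s * w * q ^ n) q)) \<longlonglongrightarrow> inverse (qpoch_inf 0 q)"
        by (intro tendsto_intros qpoch_inf_tendsto[OF q] power_q_tendsto_0[OF q]) (simp add: qpoch_inf_0[OF q])
      then obtain K2 where K2: "K2 > 0" "\<And>k. norm (inverse (qpoch_inf (s * w * q ^ k) q)) \<le> K2"
        using LIMSEQ_imp_norm_bounded by meson
      have "norm (aa_weight q u v (s * q ^ N) t (w * q ^ k)) \<le> K1 * K2" for N k
      proof -
        \<comment> \<open>The factor containing \<open>s\<close> depends on \<open>N\<close> and
          \<open>k\<close> only through \<open>N + k\<close>, so boundedness of a single convergent
          sequence suffices.\<close>
        have "aa_weight q u v (s * q ^ N) t (w * q ^ k) =
            aa_weight q u v 0 t (w * q ^ k) * inverse (qpoch_inf (s * w * q ^ (N + k)) q)"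
          by (simp add: aa_weight_def qpoch_inf_0[OF q] power_add field_simps)
        then show ?thesis using K1 K2(1) K2(2)[of "N + k"]
          by (simp only: norm_mult) (intro mult_mono, auto intro: less_imp_le)
      qed
      then show ?thesis by blast
    qed
    obtain K1 where K1: "\<And>N k. norm (aa_weight q u v (s * q ^ N) t (u * q ^ k)) \<le> K1" using bd by metis
    obtain K2 where K2: "\<And>N k. norm (aa_weight q u v (s * q ^ N) t (v * q ^ k)) \<le> K2" using bd by metis
    have "(\<lambda>N. ?J (s * q ^ N)) \<longlonglongrightarrow> ?J 0"
      by (rule jackson_integral_tendsto[where K = "max K1 K2"])
         (use pt K1 K2 in \<open>auto simp: le_max_iff_disj\<close>)
    then show "(\<lambda>n. qpoch_inf (s * q ^ n * u) q * qpoch_inf (s * q ^ n * v) q * ?J (s * q ^ n))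
        \<longlonglongrightarrow> qpoch_inf (0 * u) q * qpoch_inf (0 * v) q * ?J 0"
      by (intro tendsto_intros qpoch_inf_tendsto[OF q] power_q_tendsto_0[OF q])
    show "(\<lambda>n. qpoch_inf (s * q ^ n * (t * u * v)) q) \<longlonglongrightarrow> qpoch_inf (0 * (t * u * v)) q"
      by (intro tendsto_intros qpoch_inf_tendsto[OF q] power_q_tendsto_0[OF q])
  qed
  then show ?thesis by (simp add: qpoch_inf_0[OF q] mult_ac)
qed

lemma andrews_askey_reduce_0:
  assumes su: "\<And>n. s * u * q ^ n \<noteq> 1" and sv: "\<And>n. s * v * q ^ n \<noteq> 1"
    and tu: "\<And>n. t * u * q ^ n \<noteq> 1" and tv: "\<And>n. t * v * q ^ n \<noteq> 1"
  shows "qpoch_inf (s * u) q * qpoch_inf (s * v) q * qpoch_inf (t * u) q * qpoch_inf (t * v) q *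
      jackson_integral q u v (aa_weight q u v s t) =
    qpoch_inf (s * t * u * v) q * jackson_integral q u v (aa_weight q u v 0 0)"
proof -
  let ?J = "\<lambda>s t. jackson_integral q u v (aa_weight q u v s t)"
  have "qpoch_inf (s * u) q * qpoch_inf (s * v) q * qpoch_inf (t * u) q * qpoch_inf (t * v) q * ?J s t
      = qpoch_inf (t * u) q * qpoch_inf (t * v) q * (qpoch_inf (s * u) q * qpoch_inf (s * v) q * ?J s t)"
    by (simp add: mult_ac)
  also have "\<dots> = qpoch_inf (s * t * u * v) q * (qpoch_inf (t * u) q * qpoch_inf (t * v) q * ?J t 0)"
    unfolding andrews_askey_reduce[OF su sv tu tv] aa_weight_commute[of u v 0 t] by (simp add: mult_ac)
  also have "qpoch_inf (t * u) q * qpoch_inf (t * v) q * ?J t 0 = ?J 0 0"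
    using andrews_askey_reduce[of t 0, OF tu tv] by (simp add: qpoch_inf_0[OF q])
  finally show ?thesis .
qed

context
  assumes uv: "\<And>n. u / v * q ^ n \<noteq> 1" and vu: "\<And>n. q * v / u * q ^ n \<noteq> 1"
begin

text \<open>For \<open>s = q / u\<close> and \<open>t = q / v\<close> the integrand is identically 1.\<close>

lemma andrews_askey_0_0:
  "jackson_integral q u v (aa_weight q u v 0 0) =
     (1 - q) * v * qpoch_inf q q * qpoch_inf (u / v) q * qpoch_inf (q * v / u) q"
proof -
  have qq: "q * q ^ n \<noteq> 1" for n
    using norm_mult_power_lt_1[OF q q, of n] by force
  have uv': "q * u / v * q ^ n \<noteq> 1" for n
    using uv[of "Suc n"] by (simp add: mult_ac)
  have a: "q / u * u * q ^ n \<noteq> 1" "q / u * v * q ^ n \<noteq> 1" "q / v * u * q ^ n \<noteq> 1" "q / v * v * q ^ n \<noteq> 1" for n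
    using qq[of n] vu[of n] uv'[of n] u v by (simp_all add: mult_ac)
  have one: "aa_weight q u v (q / u) (q / v) (w * q ^ n) = 1"
    if "\<And>n. q / u * w * q ^ n \<noteq> 1" "\<And>n. q / v * w * q ^ n \<noteq> 1" for w n
    using lattice_nonzero[OF that(1), of n] lattice_nonzero[OF that(2), of n] by (simp add: aa_weight_def)
  have "jackson_integral q u v (aa_weight q u v (q / u) (q / v)) = jackson_integral q u v (\<lambda>_. 1)"
    by (rule jackson_integral_cong) (rule one[OF a(1) a(3)], rule one[OF a(2) a(4)])
  also have "\<dots> = v - u"
    using q by (simp add: jackson_integral_def suminf_mult suminf_geometric summable_geometric) (auto)
  finally have J: "jackson_integral q u v (aa_weight q u v (q / u) (q / v)) = v - u" .
  \<comment> \<open>Here \<open>s * t * u * v\<close> is \<open>q * q\<close>. The right-hand side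
    is then regrouped to expose the nonzero factor \<open>qpoch_inf (q * q) q\<close>, which
    cancels.\<close>
  have "qpoch_inf (q * q) q * jackson_integral q u v (aa_weight q u v 0 0) =
      qpoch_inf q q * qpoch_inf (q * v / u) q * qpoch_inf (q * u / v) q * qpoch_inf q q * (v - u)"
    using andrews_askey_reduce_0[of "q / u" "q / v", OF a] u v unfolding J by (simp add: mult_ac)
  also have "\<dots> = qpoch_inf q q * (qpoch_inf q q * qpoch_inf (q * v / u) q * ((v - u) * qpoch_inf (q * u / v) q))"
    by (simp only: mult_ac)
  also have "(v - u) * qpoch_inf (q * u / v) q = v * qpoch_inf (u / v) q"
  proof -
    have "v * qpoch_inf (u / v) q = (v * (1 - u / v)) * qpoch_inf (q * u / v) q"
      by (subst qpoch_inf_rec[OF q]) simp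
    also have "v * (1 - u / v) = v - u" using v by (simp add: right_diff_distrib)
    finally show ?thesis by simp
  qed
  also have "qpoch_inf q q * (qpoch_inf q q * qpoch_inf (q * v / u) q * (v * qpoch_inf (u / v) q))
      = qpoch_inf (q * q) q * ((1 - q) * v * qpoch_inf q q * qpoch_inf (u / v) q * qpoch_inf (q * v / u) q)"
    by (subst qpoch_inf_rec[OF q, of q]) (simp only: mult_ac)
  finally show ?thesis
    using norm_mult_power_lt_1[OF q q, of 1] qpoch_inf_nonzero_norm[OF q, of "q * q"] by simp
qed

end

end

end

section \<open>Moments of the Andrews-Askey weight and the resulting 3phi2\<close>

context
  fixes q u v s t :: complex
  assumes q: "norm q < 1" and u: "u \<noteq> 0" and v: "v \<noteq> 0"
    and su: "\<And>n. s * u * q ^ n \<noteq> 1" and sv: "\<And>n. s * v * q ^ n \<noteq> 1"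
    and tu: "\<And>n. t * u * q ^ n \<noteq> 1" and tv: "\<And>n. t * v * q ^ n \<noteq> 1"
begin

text \<open>The test polynomials vanish at the first \<open>n\<close> points of the lattice of
  \<open>v\<close>, unlike powers of \<open>x\<close>; this is what gives a recurrence with two
  terms. For \<open>n = 0\<close> it is the Andrews-Askey integral itself.\<close>

abbreviation aa_moment :: "nat \<Rightarrow> complex" where
  "aa_moment n \<equiv> jackson_integral q u v (\<lambda>x. aa_weight q u v s t x * (\<Prod>k<n. x - v * q ^ k))"

lemma aa_weight_prod_tendsto:
  "(\<lambda>m. aa_weight q u v s t (w * q ^ m) * (\<Prod>k<n. w * q ^ m - v * q ^ k)) \<longlonglongrightarrow> 1 * (\<Prod>k<n. 0 - v * q ^ k)"
  by (intro tendsto_intros aa_weight_tendsto[OF q] power_q_tendsto_0[OF q])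

lemma aa_weight_prod_summable:
  "jackson_summable q u v (\<lambda>x. aa_weight q u v s t x * (\<Prod>k<n. x - v * q ^ k))"
  by (rule jackson_summableI[OF q]) (rule aa_weight_prod_tendsto)+

text \<open>Telescoping as in the Andrews-Askey recurrence, but in the index \<open>n\<close> with
  \<open>s\<close> and \<open>t\<close> fixed. The boundary function vanishes at \<open>u\<close>
  through \<open>(x/u;q)_inf\<close> and at \<open>v\<close> through the factor \<open>x - v\<close>
  of the polynomial, which is why it contains \<open>q * x / v\<close> and not
  \<open>x / v\<close>.\<close>

lemma aa_moment_Suc:
  "(1 - s * t * u * v * q ^ n) * aa_moment (Suc n) =
     u * (1 - s * v * q ^ n) * (1 - t * v * q ^ n) * aa_moment n"
proof -
  define p where "p m x = (\<Prod>k<m. x - v * q ^ k)" for m and x :: complex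
  define f where "f x = u * (qpoch_inf (x / u) q * qpoch_inf (q * x / v) q * p (Suc n) x /
      (qpoch_inf (s * x) q * qpoch_inf (t * x) q))" for x
  define C D where "C = u * (1 - s * v * q ^ n) * (1 - t * v * q ^ n)" and "D = 1 - s * t * u * v * q ^ n"
  define g where "g x = C * (aa_weight q u v s t x * p n x) + (- D) * (aa_weight q u v s t x * p (Suc n) x)" for x
  have key: "x * g x = f x - f (q * x)"
    if "qpoch_inf (s * x) q \<noteq> 0" "qpoch_inf (t * x) q \<noteq> 0" for x
  proof -
    define A B S T where "A = qpoch_inf (q * x / u) q" and "B = qpoch_inf (q * (q * x / v)) q"
      and "S = qpoch_inf (q * (s * x)) q" and "T = qpoch_inf (q * (t * x)) q"
    have r: "qpoch_inf (x / u) q = (1 - x / u) * A" "qpoch_inf (q * x / v) q = (1 - q * x / v) * B"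
      "qpoch_inf (s * x) q = (1 - s * x) * S" "qpoch_inf (t * x) q = (1 - t * x) * T"
      using qpoch_inf_rec[OF q, of "x / u"] qpoch_inf_rec[OF q, of "q * x / v"]
        qpoch_inf_rec[OF q, of "s * x"] qpoch_inf_rec[OF q, of "t * x"]
      by (simp_all add: A_def B_def S_def T_def)
    define E F where "E = 1 - s * x" and "F = 1 - t * x"
    have nz: "S \<noteq> 0" "T \<noteq> 0" "E \<noteq> 0" "F \<noteq> 0" using that r by (auto simp: E_def F_def)
    have e: "s * (q * x) = q * (s * x)" "t * (q * x) = q * (t * x)" "q * s * x = q * (s * x)" by auto
    define Q where "Q = q ^ n"
    define K where "K = A * ((1 - q * x / v) * B) * p n x / (S * T)"
    have pS: "p (Suc n) x = (x - v * Q) * p n x" by (simp add: p_def Q_def)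
    \<comment> \<open>The dilation splits off \<open>q * x - v\<close>, which supplies the factor
      \<open>1 - q * x / v\<close> missing from \<open>B\<close>; thus \<open>f x\<close> and
      \<open>f (q * x)\<close> share the factor \<open>K\<close>.\<close>
    have pq: "p (Suc n) (q * x) = - v * (1 - q * x / v) * Q * p n x"
    proof -
      have "q * x - v = - v * (1 - q * x / v)" using v by (simp add: right_diff_distrib)
      then show ?thesis unfolding p_def Q_def prod_shift_mult_q by simp
    qed
    have fx: "f x = K * ((u - x) * (x - v * Q) / (E * F))"
    proof -
      have "u * (1 - x / u) = u - x" using u by (simp add: right_diff_distrib)
      then show ?thesis
        unfolding f_def r pS K_def E_def[symmetric] F_def[symmetric] by (simp add: divide_inverse mult_ac)
    qed
    have fqx: "f (q * x) = K * (- u * v * Q)"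
      unfolding f_def e pq K_def A_def B_def S_def T_def by (simp add: mult_ac)
    have w: "aa_weight q u v s t x * p n x = K / (E * F)"
      unfolding aa_weight_def r K_def E_def[symmetric] F_def[symmetric] by (simp add: A_def mult_ac)
    then have w': "aa_weight q u v s t x * p (Suc n) x = K * (x - v * Q) / (E * F)"
      unfolding pS by (metis (no_types, lifting) mult.assoc mult.commute times_divide_eq_left)
    have "x * (C - D * (x - v * Q)) = (u - x) * (x - v * Q) + u * v * Q * (E * F)"
      unfolding C_def D_def E_def F_def Q_def[symmetric] by (simp add: algebra_simps)
    moreover have "K * (Y + Z * (E * F)) / (E * F) = K * (Y / (E * F) + Z)" for Y Z
      using nz by (simp add: field_simps)
    ultimately have "K * (x * (C - D * (x - v * Q))) / (E * F) = K * (((u - x) * (x - v * Q)) / (E * F) + u * v * Q)"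
      by (simp only:)
    moreover have "x * g x = K * (x * (C - D * (x - v * Q))) / (E * F)"
      unfolding g_def w w' by (simp add: divide_inverse algebra_simps)
    moreover have "f x - f (q * x) = K * (((u - x) * (x - v * Q)) / (E * F) + u * v * Q)"
      unfolding fx fqx by (simp add: algebra_simps)
    ultimately show ?thesis by simp
  qed
  have lim: "(\<lambda>m. f (w * q ^ m)) \<longlonglongrightarrow> u * p (Suc n) 0" for w
  proof -
    have "(\<lambda>m. f (w * q ^ m)) \<longlonglongrightarrow> u * (qpoch_inf (0 / u) q * qpoch_inf (q * 0 / v) q * p (Suc n) 0 /
      (qpoch_inf (s * 0) q * qpoch_inf (t * 0) q))"
      unfolding f_def divide_inverse p_def
      by (intro tendsto_intros qpoch_inf_tendsto[OF q] power_q_tendsto_0[OF q]) (simp add: qpoch_inf_0[OF q])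
    then show ?thesis by (simp add: qpoch_inf_0[OF q])
  qed
  have "jackson_integral q u v g = (1 - q) * (f v - f u)"
    by (rule jackson_integral_q_diff[OF q key key lim lim])
       (use lattice_nonzero[OF q] su sv tu tv in auto)
  moreover have "f u = 0" using u by (simp add: f_def qpoch_inf_1[OF q])
  moreover have "f v = 0" by (auto simp: f_def p_def prod.lessThan_Suc_shift simp del: prod.lessThan_Suc)
  moreover have "jackson_integral q u v g = C * aa_moment n + (- D) * aa_moment (Suc n)"
    unfolding g_def p_def
    by (intro jackson_integral_linear[OF q] aa_weight_prod_summable)
  ultimately have "C * aa_moment n = D * aa_moment (Suc n)" by simp
  then show ?thesis unfolding C_def D_def by (rule sym)
qed

lemma aa_moment_eq:
  "qpoch (s * t * u * v) q n * aa_moment n = u ^ n * qpoch (s * v) q n * qpoch (t * v) q n * aa_moment 0"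
proof (induction n)
  case (Suc n)
  have "qpoch (s * t * u * v) q (Suc n) * aa_moment (Suc n)
      = qpoch (s * t * u * v) q n * ((1 - s * t * u * v * q ^ n) * aa_moment (Suc n))"
    by (simp add: qpoch_Suc[OF q])
  also have "\<dots> = u * (1 - s * v * q ^ n) * (1 - t * v * q ^ n) * (qpoch (s * t * u * v) q n * aa_moment n)"
    unfolding aa_moment_Suc by (simp only: mult_ac)
  also have "\<dots> = u ^ Suc n * qpoch (s * v) q (Suc n) * qpoch (t * v) q (Suc n) * aa_moment 0"
    unfolding Suc.IH by (simp add: qpoch_Suc[OF q] mult_ac)
  finally show ?case .
qed (simp add: qpoch_0[OF q])

context
  fixes \<alpha> d :: complex
  assumes d: "norm d < 1" and u1: "norm u < 1" and v1: "norm v < 1"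
    and nz: "\<And>n. \<alpha> * d * v * q ^ n \<noteq> 1"
begin

text \<open>Exchange of the q-Gauss series with the Jackson integral. The partial sums are bounded
  by \<open>K / (1 - norm d)\<close> on the unit disc; for the weight, which may have poles
  elsewhere, a bound along the two lattices is enough.\<close>

lemma jackson_gauss_sums:
  "(\<lambda>n. gauss_coeff q \<alpha> d v n * aa_moment n) sums
     jackson_integral q u v (\<lambda>x. aa_weight q u v s t x * gauss_sum q \<alpha> d v x)"
proof -
  define p where "p m x = (\<Prod>k<m. x - v * q ^ k)" for m and x :: complex
  define c where "c = gauss_coeff q \<alpha> d v"
  define S where "S N x = (\<Sum>n<N. c n * p n x)" for N x
  define w where "w = aa_weight q u v s t"
  have part: "jackson_summable q u v (\<lambda>x. w x * S N x) \<and>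
      jackson_integral q u v (\<lambda>x. w x * S N x) = (\<Sum>n<N. c n * aa_moment n)" for N
  proof (induction N)
    case 0
    show ?case by (simp add: S_def jackson_integral_def jackson_summable_def)
  next
    case (Suc N)
    have e: "(\<lambda>x. w x * S (Suc N) x) = (\<lambda>x. 1 * (w x * S N x) + c N * (w x * p N x))"
      by (simp add: S_def fun_eq_iff algebra_simps)
    have s2: "jackson_summable q u v (\<lambda>x. w x * p N x)"
      unfolding w_def p_def by (rule aa_weight_prod_summable)
    have "jackson_summable q u v (\<lambda>x. w x * S (Suc N) x)"
      unfolding e by (rule jackson_summable_linear[OF q _ s2]) (use Suc in simp)
    moreover have "jackson_integral q u v (\<lambda>x. w x * S (Suc N) x) =
        1 * jackson_integral q u v (\<lambda>x. w x * S N x) + c N * jackson_integral q u v (\<lambda>x. w x * p N x)"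
      unfolding e by (rule jackson_integral_linear[OF q _ s2]) (use Suc in simp)
    ultimately show ?case using Suc by (simp add: w_def p_def)
  qed
  have le1: "norm (y * q ^ k) \<le> 1" if "norm y < 1" for y k
    using norm_mult_power_lt_1[OF q that, of k] by simp
  obtain K where K: "K > 0" "\<And>n x. norm x \<le> 1 \<Longrightarrow> norm (c n * p n x) \<le> K * norm d ^ n"
    using gauss_term_bounded[OF q d v1 nz] unfolding c_def p_def by metis
  have SK: "norm (S N x) \<le> K / (1 - norm d)" if "norm x \<le> 1" for N x
  proof -
    have "norm (S N x) \<le> (\<Sum>n<N. K * norm d ^ n)"
      unfolding S_def using K(2)[OF that] by (intro sum_norm_le) auto
    also have "\<dots> \<le> (\<Sum>n. K * norm d ^ n)"
      using d K(1) by (intro sum_le_suminf summable_mult summable_geometric) auto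
    also have "\<dots> = K / (1 - norm d)"
      using d by (simp add: suminf_mult suminf_geometric summable_geometric)
    finally show ?thesis .
  qed
  obtain K1 where K1: "\<And>k. norm (w (u * q ^ k)) \<le> K1" "K1 > 0"
    using LIMSEQ_imp_norm_bounded[OF aa_weight_tendsto[OF q, of u v s t u]] unfolding w_def by blast
  obtain K2 where K2: "\<And>k. norm (w (v * q ^ k)) \<le> K2" "K2 > 0"
    using LIMSEQ_imp_norm_bounded[OF aa_weight_tendsto[OF q, of u v s t v]] unfolding w_def by blast
  have bd: "norm (w x * S N x) \<le> max K1 K2 * (K / (1 - norm d))"
    if "norm x \<le> 1" "norm (w x) \<le> max K1 K2" for N x
    unfolding norm_mult using SK[OF that(1), of N] that(2) K1(2) by (intro mult_mono) auto
  have lim: "(\<lambda>N. w x * S N x) \<longlonglongrightarrow> w x * gauss_sum q \<alpha> d v x" if "norm x \<le> 1" for x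
    using gauss_sums[OF q d v1 nz that] unfolding sums_def S_def c_def p_def by (intro tendsto_intros)
  have "(\<lambda>N. jackson_integral q u v (\<lambda>x. w x * S N x)) \<longlonglongrightarrow>
      jackson_integral q u v (\<lambda>x. w x * gauss_sum q \<alpha> d v x)"
    by (rule jackson_integral_tendsto[OF q, where K = "max K1 K2 * (K / (1 - norm d))"])
       (intro lim bd le1 u1 v1 order_trans[OF K1(1)] order_trans[OF K2(1)] max.cobounded1 max.cobounded2)+
  then show ?thesis
    using part unfolding sums_def by (simp add: w_def c_def)
qed

context
  assumes uv: "\<And>n. u / v * q ^ n \<noteq> 1" and vu: "\<And>n. q * v / u * q ^ n \<noteq> 1"
    and stuv: "\<And>n. s * t * u * v * q ^ n \<noteq> 1"
begin

text \<open>After the q-Gauss expansion and termwise integration, \<open>aa_moment_eq\<close>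
  contributes \<open>(s v;q)_n (t v;q)_n u^n / (s t u v;q)_n\<close> to the term with index
  \<open>n\<close>. The common factor \<open>?J\<close> is the Andrews-Askey integral in closed
  form.\<close>

lemma jackson_integral_eq_basic_hyp:
  "jackson_integral q u v (\<lambda>x. aa_weight q u v s t x * (qpoch_inf (\<alpha> * d * x) q / qpoch_inf (d * x) q)) =
   (1 - q) * v * qpoch_inf q q * qpoch_inf (u / v) q * qpoch_inf (q * v / u) q * qpoch_inf (\<alpha> * d * v) q *
     qpoch_inf (s * t * u * v) q /
   (qpoch_inf (d * v) q * (qpoch_inf (s * u) q * qpoch_inf (s * v) q * qpoch_inf (t * u) q * qpoch_inf (t * v) q)) *
   basic_hyp [\<alpha>, s * v, t * v] [\<alpha> * d * v, s * t * u * v] q (d * u)"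
proof -
  let ?J = "jackson_integral q u v (aa_weight q u v s t)"
  define R where "R = qpoch_inf (\<alpha> * d * v) q / qpoch_inf (d * v) q"
  have dv: "qpoch_inf (d * v) q \<noteq> 0"
    by (intro qpoch_inf_nonzero_norm[OF q] norm_mult_lt_1 d v1)
  have frac: "qpoch_inf (\<alpha> * d * x) q / qpoch_inf (d * x) q = R * gauss_sum q \<alpha> d v x" if "norm x < 1" for x
  proof -
    have "qpoch_inf (d * x) q \<noteq> 0"
      by (intro qpoch_inf_nonzero_norm[OF q] norm_mult_lt_1 d that)
    then show ?thesis
      using q_gauss[OF q d v1 nz, of x] that dv unfolding R_def by (simp add: divide_simps mult_ac)
  qed
  have c: "gauss_coeff q \<alpha> d v n * aa_moment n = ?J *
      (qpochs [\<alpha>, s * v, t * v] q n / qpochs (q # [\<alpha> * d * v, s * t * u * v]) q n * (d * u) ^ n)" for n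
  proof -
    have "qpoch (s * t * u * v) q n \<noteq> 0" by (rule qpoch_nonzero[OF q stuv])
    then have "aa_moment n = u ^ n * qpoch (s * v) q n * qpoch (t * v) q n * ?J / qpoch (s * t * u * v) q n"
      using aa_moment_eq[of n] by (simp add: field_simps)
    then show ?thesis
      by (simp add: gauss_coeff_def qpochs_def power_mult_distrib divide_inverse mult_ac)
  qed
  have J: "(qpoch_inf (s * u) q * qpoch_inf (s * v) q * qpoch_inf (t * u) q * qpoch_inf (t * v) q) * ?J =
     qpoch_inf (s * t * u * v) q * ((1 - q) * v * qpoch_inf q q * qpoch_inf (u / v) q * qpoch_inf (q * v / u) q)"
    unfolding andrews_askey_reduce_0[OF q u v su sv tu tv] andrews_askey_0_0[OF q u v uv vu] ..
  have nzs: "qpoch_inf (s * u) q * qpoch_inf (s * v) q * qpoch_inf (t * u) q * qpoch_inf (t * v) q \<noteq> 0"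
    using qpoch_inf_nonzero[OF q su] qpoch_inf_nonzero[OF q sv] qpoch_inf_nonzero[OF q tu] qpoch_inf_nonzero[OF q tv]
    by simp
  have "isCont (gauss_sum q \<alpha> d v) 0"
    using continuous_on_interior[OF gauss_sum_continuous[OF q d v1 nz]] by simp
  then have L: "(\<lambda>n. gauss_sum q \<alpha> d v (w * q ^ n)) \<longlonglongrightarrow> gauss_sum q \<alpha> d v 0" for w
    by (rule isCont_tendsto_compose) (rule power_q_tendsto_0[OF q])
  have sm: "jackson_summable q u v (\<lambda>x. aa_weight q u v s t x * gauss_sum q \<alpha> d v x)"
    by (rule jackson_summableI[OF q]) (rule tendsto_mult[OF aa_weight_tendsto[OF q] L])+
  have "jackson_integral q u v (\<lambda>x. aa_weight q u v s t x * (qpoch_inf (\<alpha> * d * x) q / qpoch_inf (d * x) q))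
      = jackson_integral q u v (\<lambda>x. aa_weight q u v s t x * (R * gauss_sum q \<alpha> d v x))"
    by (rule jackson_integral_cong[OF q])
       (simp_all add: frac norm_mult_power_lt_1[OF q] u1 v1)
  also have "\<dots> = R * jackson_integral q u v (\<lambda>x. aa_weight q u v s t x * gauss_sum q \<alpha> d v x)"
    using jackson_integral_linear[OF q sm sm, of R 0] by (simp add: mult_ac)
  also have "jackson_integral q u v (\<lambda>x. aa_weight q u v s t x * gauss_sum q \<alpha> d v x) =
      ?J * basic_hyp [\<alpha>, s * v, t * v] [\<alpha> * d * v, s * t * u * v] q (d * u)"
  proof -
    have sm': "summable (\<lambda>n. gauss_coeff q \<alpha> d v n * aa_moment n)"
      using jackson_gauss_sums by (rule sums_summable)
    show ?thesis
    \<comment> \<open>Summability of the 3phi2 is recovered from the series of moments by cancelling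
      \<open>?J\<close>. If \<open>?J\<close> is 0, both sides are 0 whatever the value of
      \<open>basic_hyp\<close>.\<close>
    proof (cases "?J = 0")
      case True
      then show ?thesis using jackson_gauss_sums unfolding c by (simp add: sums_iff)
    next
      case False
      then have "summable (\<lambda>n. qpochs [\<alpha>, s * v, t * v] q n / qpochs (q # [\<alpha> * d * v, s * t * u * v]) q n * (d * u) ^ n)"
        using sm' unfolding c by (simp only: summable_cmult_iff) simp
      then show ?thesis
        using sums_unique[OF jackson_gauss_sums] unfolding c basic_hyp_def by (simp only: suminf_mult)
    qed
  qed
  also have "?J = qpoch_inf (s * t * u * v) q * ((1 - q) * v * qpoch_inf q q * qpoch_inf (u / v) q * qpoch_inf (q * v / u) q) /
     (qpoch_inf (s * u) q * qpoch_inf (s * v) q * qpoch_inf (t * u) q * qpoch_inf (t * v) q)"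
    using J nzs by (metis nonzero_mult_div_cancel_left)
  finally show ?thesis by (simp add: R_def mult_ac)
qed

end

end

end

section \<open>The Askey--Wilson integral\<close>

text \<open>Cauchy's theorem between two circles. Since \<open>dz = i z d\<theta>\<close>, the
  factor beside \<open>f\<close> is the differential. For complex \<open>q\<close> the passage from
  \<open>z\<close> to \<open>q z\<close> also rotates, and the inner circle has to be parametrised
  accordingly.\<close>

lemma circle_integral_mult_q:
  fixes f :: "complex \<Rightarrow> complex"
  assumes f: "f holomorphic_on S" and S: "open S" "\<And>z. norm q \<le> norm z \<Longrightarrow> norm z \<le> 1 \<Longrightarrow> z \<in> S"
    and q: "norm q < 1" "q \<noteq> 0"
  shows "integral {-pi..pi} (\<lambda>\<theta>. f (cis \<theta>) * cis \<theta>) =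
    integral {-pi..pi} (\<lambda>\<theta>. f (q * cis \<theta>) * (q * cis \<theta>))"
proof -
  define A where "A = Arg q"
  define g0 where "g0 = part_circlepath 0 1 (-pi) pi"
  \<comment> \<open>Starting at the angle \<open>A - pi\<close>, with \<open>A = Arg q\<close>,
    makes \<open>g1\<close> the image of \<open>g0\<close> under multiplication by
    \<open>q\<close>.\<close>
  define g1 where "g1 = part_circlepath 0 (norm q) (A - pi) (A + pi)"
  have qA: "q = of_real (norm q) * cis A" using q by (simp add: A_def cis_Arg sgn_eq)
  have L: "exp (Ln q) = q" using q by simp
  have "homotopic_loops S g0 g1"
    unfolding homotopic_loops
  \<comment> \<open>At stage \<open>s\<close> the loop is the unit circle multiplied by
    \<open>exp (s * Ln q)\<close>: its radius is \<open>norm q powr s\<close>, and it is rotated by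
    \<open>s * Arg q\<close>. It stays in the closed annulus and ends at \<open>g1\<close> with
    matching parametrisation.\<close>
  proof (intro exI[of _ "\<lambda>p. exp (of_real (fst p) * Ln q) * exp (\<i> * of_real (-pi + 2 * pi * snd p))"] conjI ballI)
    show "continuous_on ({0..1::real} \<times> {0..1::real})
      (\<lambda>p. exp (complex_of_real (fst p) * Ln q) * exp (\<i> * complex_of_real (-pi + 2 * pi * snd p)))"
      by (intro continuous_intros)
    have "norm q \<le> norm q powr s \<and> norm q powr s \<le> 1" if "0 \<le> s" "s \<le> 1" for s :: real
      using q that powr_le1[of s "norm q"] powr_mono'[of s 1 "norm q"] by simp
    moreover have "norm (exp (complex_of_real s * Ln q)) = norm q powr s" for s
      using q by (simp add: norm_exp_eq_Re powr_def)
    ultimately show "(\<lambda>p. exp (complex_of_real (fst p) * Ln q) * exp (\<i> * complex_of_real (-pi + 2 * pi * snd p)))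
        \<in> {0..1} \<times> {0..1} \<rightarrow> S"
      by (intro Pi_I S(2)) (auto simp: norm_mult)
  next
    fix x :: real
    have "- pi + 2 * pi * x = linepath (- pi) pi x"
      by (simp add: linepath_def algebra_simps)
    then show "exp (complex_of_real (fst (0, x)) * Ln q) * exp (\<i> * complex_of_real (-pi + 2 * pi * snd (0, x))) = g0 x"
      by (simp add: g0_def part_circlepath_def)
    have e: "A + (- pi + 2 * pi * x) = linepath (A - pi) (A + pi) x"
      by (simp add: linepath_def algebra_simps)
    have "exp (complex_of_real (fst (1, x)) * Ln q) * exp (\<i> * complex_of_real (-pi + 2 * pi * snd (1, x)))
        = of_real (norm q) * (cis A * cis (- pi + 2 * pi * x))"
      using L qA by (simp add: cis_conv_exp mult.assoc)
    also have "\<dots> = g1 x"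
      unfolding cis_mult e g1_def by (simp add: part_circlepath_def cis_conv_exp)
    finally show "exp (complex_of_real (fst (1, x)) * Ln q) * exp (\<i> * complex_of_real (-pi + 2 * pi * snd (1, x))) = g1 x" .
  next
    fix t :: real
    have "exp (\<i> * complex_of_real (-pi + 2 * pi)) = exp (\<i> * complex_of_real (-pi))"
      by (simp add: complex_eq_iff exp_eq_polar flip: cis_conv_exp)
    then show "pathfinish ((\<lambda>p. exp (complex_of_real (fst p) * Ln q) * exp (\<i> * complex_of_real (-pi + 2 * pi * snd p))) \<circ> Pair t)
      = pathstart ((\<lambda>p. exp (complex_of_real (fst p) * Ln q) * exp (\<i> * complex_of_real (-pi + 2 * pi * snd p))) \<circ> Pair t)"
      by (simp add: pathfinish_def pathstart_def)
  qed
  then have eq: "contour_integral g0 f = contour_integral g1 f"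
    by (rule Cauchy_theorem_homotopic_loops[OF _ S(1) f]) (simp_all add: g0_def g1_def)
  have g0: "path_image g0 \<subseteq> S" and g1: "path_image g1 \<subseteq> S"
    using q by (auto simp: g0_def g1_def path_image_def part_circlepath_def norm_mult intro!: S(2))
  have "(f has_contour_integral contour_integral g0 f) g0"
    using contour_integrable_holomorphic_simple[OF f S(1) _ g0] by (simp add: g0_def has_contour_integral_integral)
  then have i0: "((\<lambda>t. f (cis t) * \<i> * cis t) has_integral contour_integral g0 f) {-pi..pi}"
    unfolding g0_def by (subst (asm) has_contour_integral_part_circlepath_iff) auto
  have "(f has_contour_integral contour_integral g1 f) g1"
    using contour_integrable_holomorphic_simple[OF f S(1) _ g1] by (simp add: g1_def has_contour_integral_integral)
  then have i1: "((\<lambda>t. f (norm q * cis t) * norm q * \<i> * cis t) has_integral contour_integral g1 f) {A - pi..A + pi}"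
    unfolding g1_def by (subst (asm) has_contour_integral_part_circlepath_iff) auto
  have "((\<lambda>t. f (norm q * cis (t + A)) * norm q * \<i> * cis (t + A)) has_integral contour_integral g1 f) {-pi..pi}"
    using has_integral_affinity'[OF i1[folded cbox_interval], of 1 A] by simp
  moreover have "f (norm q * cis (t + A)) * norm q * \<i> * cis (t + A) = \<i> * (f (q * cis t) * (q * cis t))" for t
  proof -
    have "norm q * cis (t + A) = q * cis t"
      by (subst (2) qA) (simp add: cis_mult[symmetric] mult_ac)
    then show ?thesis by (metis (no_types, lifting) mult.assoc mult.commute)
  qed
  ultimately have "((\<lambda>t. \<i> * (f (q * cis t) * (q * cis t))) has_integral contour_integral g1 f) {-pi..pi}"
    by simp
  moreover have "((\<lambda>t. \<i> * (f (cis t) * cis t)) has_integral contour_integral g0 f) {-pi..pi}"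
    using i0 by (simp add: mult_ac)
  ultimately have "integral {-pi..pi} (\<lambda>t. \<i> * (f (cis t) * cis t)) = integral {-pi..pi} (\<lambda>t. \<i> * (f (q * cis t) * (q * cis t)))"
    by (simp only: integral_unique eq)
  then show ?thesis by simp
qed

text \<open>The counterpart for \<open>q = 0\<close>, where the inner circle has shrunk to a point
  and holomorphy is required on the full disc.\<close>

lemma circle_integral_mult_0:
  fixes f :: "complex \<Rightarrow> complex"
  assumes f: "f holomorphic_on S" and S: "open S" "cball 0 1 \<subseteq> S"
  shows "integral {-pi..pi} (\<lambda>\<theta>. f (cis \<theta>) * cis \<theta>) = 0"
proof -
  have "path_image (part_circlepath 0 1 (-pi) pi) \<subseteq> cball 0 1"
    by (auto simp: path_image_def part_circlepath_def norm_mult)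
  moreover have "pathfinish (part_circlepath 0 1 (-pi) pi) = pathstart (part_circlepath 0 1 (-pi) pi)"
    by (simp add: complex_eq_iff exp_eq_polar flip: cis_conv_exp)
  ultimately have "(f has_contour_integral 0) (part_circlepath 0 1 (-pi) pi)"
    by (intro Cauchy_theorem_convex_simple[OF holomorphic_on_subset[OF f S(2)]]) auto
  then have "((\<lambda>t. f (cis t) * \<i> * cis t) has_integral 0) {-pi..pi}"
    by (subst (asm) has_contour_integral_part_circlepath_iff) auto
  then have "((\<lambda>t. \<i> * (f (cis t) * cis t)) has_integral 0) {-pi..pi}"
    by (simp add: mult_ac)
  then have "integral {-pi..pi} (\<lambda>t. \<i> * (f (cis t) * cis t)) = 0"
    by (rule integral_unique)
  then show ?thesis by simp
qed

section \<open>The Askey-Wilson weight and its q-difference equation\<close>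

definition aw_den :: "complex \<Rightarrow> complex \<Rightarrow> complex \<Rightarrow> complex \<Rightarrow> complex \<Rightarrow> complex \<Rightarrow> complex" where
  "aw_den q a b c d z = qpoch_inf (a * z) q * qpoch_inf (b * z) q * qpoch_inf (c * z) q * qpoch_inf (d * z) q"

text \<open>At \<open>z = cis \<theta>\<close> this is
  \<open>h(cos 2\<theta>;1) / h(cos \<theta>;a,b,c,d)\<close>.\<close>

definition aw_weight :: "complex \<Rightarrow> complex \<Rightarrow> complex \<Rightarrow> complex \<Rightarrow> complex \<Rightarrow> complex \<Rightarrow> complex" where
  "aw_weight q a b c d z = qpoch_inf (z\<^sup>2) q * qpoch_inf ((inverse z)\<^sup>2) q /
     (aw_den q a b c d z * aw_den q a b c d (inverse z))"

text \<open>Taken over the full circle, so that contours can be moved; by the symmetry between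
  \<open>z\<close> and \<open>inverse z\<close> the integral from 0 to pi is half of it.\<close>

definition aw_integral :: "complex \<Rightarrow> complex \<Rightarrow> complex \<Rightarrow> complex \<Rightarrow> complex \<Rightarrow> complex" where
  "aw_integral q a b c d = integral {-pi..pi} (\<lambda>\<theta>. aw_weight q a b c d (cis \<theta>))"

text \<open>This function satisfies \<open>f (q * z) = f (inverse z)\<close>, so that shifting the contour from
  \<open>|z| = 1\<close> to \<open>|z| = |q|\<close> turns into the reflection of the unit circle.\<close>

definition aw_shift_fun :: "complex \<Rightarrow> complex \<Rightarrow> complex \<Rightarrow> complex \<Rightarrow> complex \<Rightarrow> complex \<Rightarrow> complex" where
  "aw_shift_fun q a b c d z = qpoch_inf (z\<^sup>2) q * qpoch_inf ((q / z)\<^sup>2) q / (aw_den q a b c d z * aw_den q a b c d (q / z))"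

context
  fixes q :: complex
  assumes q: "norm q < 1"
begin

lemma aw_den_nonzero:
  assumes "norm (a * z) < 1" "norm (b * z) < 1" "norm (c * z) < 1" "norm (d * z) < 1"
  shows "aw_den q a b c d z \<noteq> 0"
  using assms[THEN qpoch_inf_nonzero_norm[OF q]] by (simp add: aw_den_def)

lemma aw_den_rec:
  "aw_den q a b c d z = (1 - a * z) * (1 - b * z) * (1 - c * z) * (1 - d * z) * aw_den q a b c d (q * z)"
  using qpoch_inf_rec[OF q, of "a * z"] qpoch_inf_rec[OF q, of "b * z"]
    qpoch_inf_rec[OF q, of "c * z"] qpoch_inf_rec[OF q, of "d * z"]
  by (simp add: aw_den_def mult_ac)

lemma aw_den_continuous:
  assumes "continuous_on S f" "continuous_on S g"
  shows "continuous_on S (\<lambda>x. aw_den q (f x) b c d (g x))"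
  unfolding aw_den_def
  by (intro continuous_on_mult qpoch_inf_continuous[OF q] continuous_on_const assms)

context
  fixes a b c d :: complex
  assumes a: "norm a < 1" and b: "norm b < 1" and c: "norm c < 1" and d: "norm d < 1"
begin

lemma aw_shift_fun_mult_q:
  assumes "q \<noteq> 0" "z \<noteq> 0"
  shows "aw_shift_fun q a b c d (q * z) = aw_shift_fun q a b c d (inverse z)"
proof -
  have "q / (q * z) = inverse z" "q / inverse z = q * z" using assms by (simp_all add: field_simps)
  then show ?thesis by (simp add: aw_shift_fun_def mult_ac)
qed

lemma norm_params_cis:
  "norm (a * cis \<theta>) < 1" "norm (b * cis \<theta>) < 1" "norm (c * cis \<theta>) < 1" "norm (d * cis \<theta>) < 1"
  using a b c d by (simp_all add: norm_mult)

lemma norm_params_q_cis: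
  "norm (a * (q * cis \<theta>)) < 1" "norm (b * (q * cis \<theta>)) < 1" "norm (c * (q * cis \<theta>)) < 1" "norm (d * (q * cis \<theta>)) < 1"
  using norm_mult_lt_1[OF a q] norm_mult_lt_1[OF b q] norm_mult_lt_1[OF c q] norm_mult_lt_1[OF d q]
  by (simp_all add: norm_mult)

lemmas aw_den_nonzero_cis = aw_den_nonzero[OF norm_params_cis]
lemmas aw_den_nonzero_q_cis = aw_den_nonzero[OF norm_params_q_cis]

lemma aw_shift_fun_continuous: "continuous_on UNIV (\<lambda>\<theta>. aw_shift_fun q a b c d (cis \<theta>))"
proof -
  have "q / cis \<theta> = q * cis (- \<theta>)" for \<theta> by (simp add: divide_inverse)
  then show ?thesis
    unfolding aw_shift_fun_def
    by (simp only:)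
       (intro continuous_on_divide continuous_on_mult continuous_on_power qpoch_inf_continuous[OF q]
         aw_den_continuous continuous_intros ballI no_zero_divisors aw_den_nonzero_cis aw_den_nonzero_q_cis)
qed

text \<open>Moved to \<open>|z| = |q|\<close>, the integral of \<open>aw_shift_fun\<close> against
  \<open>cis \<theta>\<close> becomes, by the symmetry of that function and the reflection of
  \<theta>, its integral against \<open>q * cis (- \<theta>)\<close>.\<close>

lemma aw_shift_integral:
  "integral {-pi..pi} (\<lambda>\<theta>. (cis \<theta> - q * cis (- \<theta>)) * aw_shift_fun q a b c d (cis \<theta>)) = 0"
proof -
  \<comment> \<open>A common bound below 1 for the parameters; the entry \<open>1 / 2\<close> keeps
    it positive, so that \<open>1 / m\<close> can serve as a radius.\<close>
  define m where "m = Max {norm a, norm b, norm c, norm d, 1 / 2}"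
  have m: "m < 1" "0 < m" "norm a \<le> m" "norm b \<le> m" "norm c \<le> m" "norm d \<le> m"
    using a b c d by (auto simp: m_def)
  have lt: "norm (e * z) < 1" if "norm e \<le> m" "norm z < 1 / m" for e z :: complex
  proof -
    have "norm (e * z) \<le> m * norm z" unfolding norm_mult using that by (intro mult_right_mono) auto
    also have "\<dots> < 1" using that m by (simp add: field_simps)
    finally show ?thesis .
  qed
  have nz: "aw_den q a b c d z \<noteq> 0" if "norm z < 1 / m" for z
    by (intro aw_den_nonzero lt m that)
  have I: "integral {-pi..pi} (\<lambda>\<theta>. aw_shift_fun q a b c d (cis \<theta>) * cis \<theta>) =
      integral {-pi..pi} (\<lambda>\<theta>. q * (cis (-\<theta>) * aw_shift_fun q a b c d (cis \<theta>)))"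
  proof (cases "q = 0")
    case True
    let ?S = "ball (0 :: complex) (1 / m)"
    have "aw_shift_fun q a b c d = (\<lambda>z. qpoch_inf (z\<^sup>2) q / aw_den q a b c d z)"
      by (simp add: aw_shift_fun_def[abs_def] True aw_den_def qpoch_inf_0)
    then have "aw_shift_fun q a b c d holomorphic_on ?S"
      using nz unfolding aw_den_def by (auto intro!: holomorphic_intros qpoch_inf_holomorphic[OF q])
    then have "integral {-pi..pi} (\<lambda>\<theta>. aw_shift_fun q a b c d (cis \<theta>) * cis \<theta>) = 0"
      by (rule circle_integral_mult_0) (use m in \<open>simp_all add: cball_subset_ball_iff\<close>)
    then show ?thesis by (simp add: True)
  next
    case False
    \<comment> \<open>This annulus is mapped to itself by \<open>z -> q / z\<close>, so one estimate
      keeps both denominators away from 0. As \<open>m < 1\<close>, it contains both circles and the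
      region between them.\<close>
    let ?S = "ball (0 :: complex) (1 / m) - cball 0 (norm q * m)"
    have z0: "z \<noteq> 0" if "z \<in> ?S" for z
      using that m by auto
    have nz2: "aw_den q a b c d (q / z) \<noteq> 0" if "z \<in> ?S" for z
      using that z0[OF that] m by (intro nz) (simp add: norm_divide field_simps)
    have "(\<lambda>z. aw_den q a b c d (g z)) holomorphic_on ?S" if "g holomorphic_on ?S" for g
      unfolding aw_den_def by (intro holomorphic_intros qpoch_inf_holomorphic[OF q] that)
    note D = this
    have Q: "(\<lambda>z. q / z) holomorphic_on ?S"
      by (intro holomorphic_intros z0)
    have "aw_den q a b c d z * aw_den q a b c d (q / z) \<noteq> 0" if "z \<in> ?S" for z
      using nz[of z] nz2[OF that] that by simp
    then have "aw_shift_fun q a b c d holomorphic_on ?S"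
      unfolding aw_shift_fun_def[abs_def]
      by (intro holomorphic_on_divide[where g = "\<lambda>z. aw_den q a b c d z * aw_den q a b c d (q / z)"]
          holomorphic_on_mult D Q qpoch_inf_holomorphic[OF q] holomorphic_on_power holomorphic_on_ident)
    moreover have "z \<in> ?S" if "norm q \<le> norm z" "norm z \<le> 1" for z
    proof -
      have "norm q * m < norm q" "1 < 1 / m" using False m by simp_all
      then have "norm q * m < norm z" "norm z < 1 / m" using that by linarith+
      then show ?thesis by simp
    qed
    ultimately have "integral {-pi..pi} (\<lambda>\<theta>. aw_shift_fun q a b c d (cis \<theta>) * cis \<theta>) =
        integral {-pi..pi} (\<lambda>\<theta>. aw_shift_fun q a b c d (q * cis \<theta>) * (q * cis \<theta>))"
      by (intro circle_integral_mult_q q False) (auto intro!: open_Diff)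
    also have "\<dots> = integral {-pi..pi} (\<lambda>\<theta>. aw_shift_fun q a b c d (cis (- \<theta>)) * (q * cis \<theta>))"
      using False by (simp add: aw_shift_fun_mult_q)
    also have "\<dots> = integral {-pi..pi} (\<lambda>\<theta>. aw_shift_fun q a b c d (cis \<theta>) * (q * cis (- \<theta>)))"
      using Henstock_Kurzweil_Integration.integral_reflect_real[of pi "-pi" "\<lambda>\<theta>. aw_shift_fun q a b c d (cis \<theta>) * (q * cis (- \<theta>))"] by simp
    finally show ?thesis by (simp add: mult_ac)
  qed
  have i: "(\<lambda>\<theta>. aw_shift_fun q a b c d (cis \<theta>) * cis \<theta>) integrable_on {-pi..pi}"
    "(\<lambda>\<theta>. q * (cis (-\<theta>) * aw_shift_fun q a b c d (cis \<theta>))) integrable_on {-pi..pi}"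
    by (intro integrable_continuous_real continuous_intros continuous_on_subset[OF aw_shift_fun_continuous] subset_UNIV)+
  have "integral {-pi..pi} (\<lambda>\<theta>. aw_shift_fun q a b c d (cis \<theta>) * cis \<theta> - q * (cis (-\<theta>) * aw_shift_fun q a b c d (cis \<theta>))) = 0"
    unfolding integral_diff[OF i] I by simp
  then show ?thesis by (simp add: algebra_simps)
qed

lemma aw_weight_continuous: "continuous_on UNIV (\<lambda>\<theta>. aw_weight q a b c d (cis \<theta>))"
  unfolding aw_weight_def cis_inverse
  by (intro continuous_on_divide continuous_on_mult continuous_on_power qpoch_inf_continuous[OF q]
      aw_den_continuous continuous_intros ballI no_zero_divisors aw_den_nonzero_cis)

lemma aw_weight_mult_q:
  "aw_weight q (q * a) b c d (cis \<theta>) = (1 - a * cis \<theta>) * (1 - a * cis (-\<theta>)) * aw_weight q a b c d (cis \<theta>)"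
proof -
  have *: "aw_den q a b c d (cis t) = (1 - a * cis t) * aw_den q (q * a) b c d (cis t)" for t
    using qpoch_inf_rec[OF q, of "a * cis t"] by (simp add: aw_den_def mult_ac)
  have "1 - a * cis t \<noteq> 0" for t using norm_params_cis(1)[of t] by auto
  then show ?thesis
    by (simp add: aw_weight_def * mult_ac)
qed

text \<open>On the unit circle \<open>z - q * w\<close> equals \<open>z * (1 - q * w^2)\<close>, and
  \<open>1 - q * w^2\<close> is the factor that completes \<open>((q w)^2;q)_inf\<close> to
  \<open>(q w^2;q)_inf\<close>. Hence the shift function and the weight share the factor
  \<open>V\<close>, which is symmetric in \<open>z\<close> and \<open>w\<close>.\<close>

lemma aw_shift_fun_eq:
  fixes \<theta> :: real
  defines "z \<equiv> cis \<theta>" and "w \<equiv> cis (-\<theta>)"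
  defines "V \<equiv> qpoch_inf (q * z\<^sup>2) q * qpoch_inf (q * w\<^sup>2) q / (aw_den q a b c d z * aw_den q a b c d w)"
  shows "(z - q * w) * aw_shift_fun q a b c d z =
      z * (1 - z\<^sup>2) * ((1 - a * w) * (1 - b * w) * (1 - c * w) * (1 - d * w)) * V"
    and "aw_weight q a b c d z = (1 - z\<^sup>2) * (1 - w\<^sup>2) * V"
proof -
  have zw: "z * w = 1" "inverse z = w" "q / z = q * w"
    by (simp_all add: z_def w_def cis_mult divide_inverse)
  define p where "p = (1 - a * w) * (1 - b * w) * (1 - c * w) * (1 - d * w)"
  have p0: "p \<noteq> 0"
    using norm_params_cis[of "-\<theta>"] by (auto simp: p_def w_def)
  have D: "aw_den q a b c d w = p * aw_den q a b c d (q * w)"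
    unfolding p_def by (rule aw_den_rec)
  have P: "qpoch_inf (q * w\<^sup>2) q = (1 - q * w\<^sup>2) * qpoch_inf ((q * w)\<^sup>2) q"
    by (subst qpoch_inf_rec[OF q]) (simp add: power2_eq_square mult_ac)
  have "z * (1 - q * w\<^sup>2) = z - q * w * (z * w)"
    by (simp add: algebra_simps power2_eq_square)
  then have zq: "z * (1 - q * w\<^sup>2) = z - q * w" by (simp add: zw)
  have "z * (1 - z\<^sup>2) * p * V = (z * (1 - q * w\<^sup>2)) * aw_shift_fun q a b c d z"
    using p0 unfolding V_def aw_shift_fun_def zw P D qpoch_inf_rec[OF q, of "z\<^sup>2"] by simp
  then show "(z - q * w) * aw_shift_fun q a b c d z =
      z * (1 - z\<^sup>2) * ((1 - a * w) * (1 - b * w) * (1 - c * w) * (1 - d * w)) * V"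
    unfolding zq p_def[symmetric] by (rule sym)
  show "aw_weight q a b c d z = (1 - z\<^sup>2) * (1 - w\<^sup>2) * V"
    unfolding V_def aw_weight_def zw qpoch_inf_rec[OF q, of "z\<^sup>2"] qpoch_inf_rec[OF q, of "w\<^sup>2"] by simp
qed

text \<open>Before integration the two sides differ by
  \<open>a * (g \<theta> + g (- \<theta>))\<close>. Adding the reflection gives the correction the
  symmetry under \<open>z -> 1/z\<close> that both weights have, and each summand integrates to
  0.\<close>

lemma aw_integral_mult_q:
  "(1 - a * b) * (1 - a * c) * (1 - a * d) * aw_integral q a b c d =
   (1 - a * b * c * d) * aw_integral q (q * a) b c d"
proof -
  define g where "g \<theta> = (cis \<theta> - q * cis (- \<theta>)) * aw_shift_fun q a b c d (cis \<theta>)" for \<theta>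
  have gc: "continuous_on UNIV g"
    unfolding g_def by (intro continuous_intros aw_shift_fun_continuous)
  have wc: "continuous_on UNIV (\<lambda>\<theta>. aw_weight q (q * a) b c d (cis \<theta>))"
    unfolding aw_weight_mult_q by (intro continuous_intros aw_weight_continuous)
  have g0: "integral {-pi..pi} g = 0"
    using aw_shift_integral by (simp add: g_def[abs_def])
  have g0': "integral {-pi..pi} (\<lambda>\<theta>. g (- \<theta>)) = 0"
    using Henstock_Kurzweil_Integration.integral_reflect_real[of pi "-pi" g] g0 by simp
  have key: "(1 - a * b) * (1 - a * c) * (1 - a * d) * aw_weight q a b c d (cis \<theta>) =
      (1 - a * b * c * d) * aw_weight q (q * a) b c d (cis \<theta>) + a * (g \<theta> + g (- \<theta>))" for \<theta>
  proof -
    define z w where "z = cis \<theta>" and "w = cis (- \<theta>)"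
    have zw: "z * w = 1" by (simp add: z_def w_def cis_mult)
    define V where "V = qpoch_inf (q * z\<^sup>2) q * qpoch_inf (q * w\<^sup>2) q / (aw_den q a b c d z * aw_den q a b c d w)"
    have g1: "g \<theta> = z * (1 - z\<^sup>2) * ((1 - a * w) * (1 - b * w) * (1 - c * w) * (1 - d * w)) * V"
      using aw_shift_fun_eq(1)[of \<theta>] by (simp only: g_def V_def z_def w_def)
    have g2: "g (- \<theta>) = w * (1 - w\<^sup>2) * ((1 - a * z) * (1 - b * z) * (1 - c * z) * (1 - d * z)) * V"
      using aw_shift_fun_eq(1)[of "- \<theta>"] by (simp add: g_def V_def z_def w_def mult_ac)
    have W: "aw_weight q a b c d z = (1 - z\<^sup>2) * (1 - w\<^sup>2) * V"
      using aw_shift_fun_eq(2)[of \<theta>] by (simp only: V_def z_def w_def)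
    have W': "aw_weight q (q * a) b c d z = (1 - a * z) * (1 - a * w) * ((1 - z\<^sup>2) * (1 - w\<^sup>2) * V)"
      using aw_weight_mult_q[of \<theta>] unfolding z_def[symmetric] w_def[symmetric] W .
    have "(1 - a * b) * (1 - a * c) * (1 - a * d) * ((1 - z\<^sup>2) * (1 - w\<^sup>2)) =
      (1 - a * b * c * d) * ((1 - a * z) * (1 - a * w) * ((1 - z\<^sup>2) * (1 - w\<^sup>2))) +
      a * (z * (1 - z\<^sup>2) * ((1 - a * w) * (1 - b * w) * (1 - c * w) * (1 - d * w)) +
           w * (1 - w\<^sup>2) * ((1 - a * z) * (1 - b * z) * (1 - c * z) * (1 - d * z)))"
    proof -
      \<comment> \<open>The quartic products are symmetric in the parameters, so the correction
        depends on them only through the elementary symmetric functions.\<close>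
      define e1 e2 e3 e4 where "e1 = a + b + c + d" and "e2 = a*b + a*c + a*d + b*c + b*d + c*d"
        and "e3 = a*b*c + a*b*d + a*c*d + b*c*d" and "e4 = a*b*c*d"
      define U where "U = (1 - z\<^sup>2) * (1 - w\<^sup>2)"
      have E: "x\<^sup>2 * ((1 - a * y) * (1 - b * y) * (1 - c * y) * (1 - d * y)) =
          x\<^sup>2 - e1 * x + e2 - e3 * y + e4 * y\<^sup>2" if "x * y = 1" for x y
      proof -
        have "(1 - a * y) * (1 - b * y) * (1 - c * y) * (1 - d * y) = 1 - e1 * y + e2 * y\<^sup>2 - e3 * y ^ 3 + e4 * y ^ 4"
          by (simp add: e1_def e2_def e3_def e4_def algebra_simps power2_eq_square power3_eq_cube power4_eq_xxxx)
        moreover have "x\<^sup>2 * (1 - e1 * y + e2 * y\<^sup>2 - e3 * y ^ 3 + e4 * y ^ 4) =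
          x\<^sup>2 - e1 * x * (x * y) + e2 * (x * y)\<^sup>2 - e3 * y * (x * y)\<^sup>2 + e4 * y\<^sup>2 * (x * y)\<^sup>2"
          by (simp add: algebra_simps power2_eq_square power3_eq_cube power4_eq_xxxx)
        ultimately show ?thesis using that by simp
      qed
      have F: "x * (1 - x\<^sup>2) = (y - x) * x\<^sup>2" if "x * y = 1" for x y :: complex
      proof -
        have "(y - x) * x\<^sup>2 = x * (x * y) - x * x\<^sup>2" by (simp add: algebra_simps power2_eq_square)
        then show ?thesis using that by (simp add: algebra_simps)
      qed
      have wz: "w * z = 1" using zw by (simp add: mult.commute)
      have "z * (1 - z\<^sup>2) * ((1 - a * w) * (1 - b * w) * (1 - c * w) * (1 - d * w)) +
           w * (1 - w\<^sup>2) * ((1 - a * z) * (1 - b * z) * (1 - c * z) * (1 - d * z))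
        = (w - z) * (z\<^sup>2 - e1 * z + e2 - e3 * w + e4 * w\<^sup>2) + (z - w) * (w\<^sup>2 - e1 * w + e2 - e3 * z + e4 * z\<^sup>2)"
        unfolding F[OF zw] F[OF wz] mult.assoc[of _ "z\<^sup>2"] mult.assoc[of _ "w\<^sup>2"] E[OF zw] E[OF wz] ..
      \<comment> \<open>The sum has the form \<open>(w - z) * (p z - p w)\<close>. The constant
        \<open>e2\<close> drops out of the difference, which contains a second factor
        \<open>z - w\<close>.\<close>
      also have "\<dots> = - (z - w)\<^sup>2 * ((1 - e4) * (z + w) - (e1 - e3))"
        by (simp add: algebra_simps power2_eq_square)
      also have "- (z - w)\<^sup>2 = U"
      proof -
        have "U = 1 + (z * w)\<^sup>2 - z\<^sup>2 - w\<^sup>2" by (simp add: U_def algebra_simps power_mult_distrib)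
        also have "\<dots> = 2 * (z * w) - z\<^sup>2 - w\<^sup>2" using zw by simp
        also have "\<dots> = - (z - w)\<^sup>2" by (simp add: algebra_simps power2_eq_square)
        finally show ?thesis by simp
      qed
      finally have S: "z * (1 - z\<^sup>2) * ((1 - a * w) * (1 - b * w) * (1 - c * w) * (1 - d * w)) +
           w * (1 - w\<^sup>2) * ((1 - a * z) * (1 - b * z) * (1 - c * z) * (1 - d * z)) =
           U * ((1 - e4) * (z + w) - (e1 - e3))" .
      have "(1 - a * z) * (1 - a * w) = 1 - a * (z + w) + a\<^sup>2 * (z * w)"
        by (simp add: algebra_simps power2_eq_square)
      then have A: "(1 - a * z) * (1 - a * w) = 1 - a * (z + w) + a\<^sup>2" using zw by simp
      \<comment> \<open>What remains is affine in \<open>s = z + w\<close>, and the coefficients of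
        \<open>s\<close> cancel because \<open>e4\<close> is \<open>a * b * c * d\<close>.\<close>
      have "(1 - a * b) * (1 - a * c) * (1 - a * d) =
          (1 - a * b * c * d) * (1 - a * s + a\<^sup>2) + a * ((1 - e4) * s - (e1 - e3))" for s
        by (simp add: e1_def e3_def e4_def algebra_simps power2_eq_square)
      then have "(1 - a * b) * (1 - a * c) * (1 - a * d) * U =
          ((1 - a * b * c * d) * (1 - a * (z + w) + a\<^sup>2) + a * ((1 - e4) * (z + w) - (e1 - e3))) * U"
        by (rule arg_cong[where f = "\<lambda>x. x * U"])
      also have "\<dots> = (1 - a * b * c * d) * ((1 - a * (z + w) + a\<^sup>2) * U) + a * (U * ((1 - e4) * (z + w) - (e1 - e3)))"
        by (simp only: distrib_right distrib_left mult_ac)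
      finally show ?thesis unfolding S A U_def[symmetric] .
    qed
    then have "((1 - a * b) * (1 - a * c) * (1 - a * d) * ((1 - z\<^sup>2) * (1 - w\<^sup>2))) * V =
      ((1 - a * b * c * d) * ((1 - a * z) * (1 - a * w) * ((1 - z\<^sup>2) * (1 - w\<^sup>2))) +
      a * (z * (1 - z\<^sup>2) * ((1 - a * w) * (1 - b * w) * (1 - c * w) * (1 - d * w)) +
           w * (1 - w\<^sup>2) * ((1 - a * z) * (1 - b * z) * (1 - c * z) * (1 - d * z)))) * V"
      by (rule arg_cong[where f = "\<lambda>x. x * V"])
    also have "\<dots> = (1 - a * b * c * d) * ((1 - a * z) * (1 - a * w) * ((1 - z\<^sup>2) * (1 - w\<^sup>2) * V)) +
      a * (z * (1 - z\<^sup>2) * ((1 - a * w) * (1 - b * w) * (1 - c * w) * (1 - d * w)) * V +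
           w * (1 - w\<^sup>2) * ((1 - a * z) * (1 - b * z) * (1 - c * z) * (1 - d * z)) * V)"
      by (simp only: distrib_right distrib_left mult.assoc)
    finally show ?thesis unfolding g1 g2 z_def[symmetric] W W' by (simp only: mult.assoc)
  qed
  have i: "h integrable_on {-pi..pi}" if "continuous_on UNIV h" for h :: "real \<Rightarrow> complex"
    by (intro integrable_continuous_real continuous_on_subset[OF that] subset_UNIV)
  have gc': "continuous_on UNIV (\<lambda>\<theta>. g (- \<theta>))"
    by (rule continuous_on_compose2[OF gc]) (auto intro!: continuous_intros)
  have "(1 - a * b) * (1 - a * c) * (1 - a * d) * aw_integral q a b c d =
      integral {-pi..pi} (\<lambda>\<theta>. (1 - a * b * c * d) * aw_weight q (q * a) b c d (cis \<theta>) + a * (g \<theta> + g (- \<theta>)))"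
    unfolding aw_integral_def key[symmetric] by simp
  also have "\<dots> = (1 - a * b * c * d) * aw_integral q (q * a) b c d +
      a * (integral {-pi..pi} g + integral {-pi..pi} (\<lambda>\<theta>. g (- \<theta>)))"
    unfolding aw_integral_def
    by (subst integral_add) (auto intro!: i continuous_intros wc gc gc' simp: integral_add i gc gc')
  finally show ?thesis by (simp add: g0 g0')
qed

end

end

section \<open>Reduction of the Askey-Wilson integral to zero parameters, and its value
  there\<close>

lemma aw_integral_commute:
  "aw_integral q a b c d = aw_integral q b a c d"
  "aw_integral q a b c d = aw_integral q c b a d"
  "aw_integral q a b c d = aw_integral q d b c a"
  by (simp_all add: aw_integral_def aw_weight_def aw_den_def mult_ac)

context
  fixes q :: complex
  assumes q: "norm q < 1"
begin

lemma aw_weight_continuous_param: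
  assumes b: "norm b < 1" and c: "norm c < 1" and d: "norm d < 1" and r: "r < 1"
  shows "continuous_on (cball 0 r \<times> S) (\<lambda>(x, \<theta>). aw_weight q x b c d (cis \<theta>))"
proof -
  have nz: "aw_den q x b c d (cis y) \<noteq> 0" if "norm x \<le> r" for x y
    using that b c d r by (intro aw_den_nonzero[OF q]) (auto simp: norm_mult)
  show ?thesis
    unfolding split_beta aw_weight_def cis_inverse
    by (intro continuous_on_divide continuous_on_mult continuous_on_power qpoch_inf_continuous[OF q]
        aw_den_continuous[OF q] continuous_intros ballI no_zero_divisors nz) auto
qed

text \<open>The pair products absorb three linear factors of the recurrence and leave
  \<open>1 - a * b * c * d\<close>. The limit is continuity of a parameter integral on the disc of
  radius \<open>norm a < 1\<close>, where no denominator vanishes.\<close>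

lemma aw_integral_reduce:
  assumes a: "norm a < 1" and b: "norm b < 1" and c: "norm c < 1" and d: "norm d < 1"
  shows "qpoch_inf (a * b) q * qpoch_inf (a * c) q * qpoch_inf (a * d) q * aw_integral q a b c d =
    qpoch_inf (a * b * c * d) q * aw_integral q 0 b c d"
proof -
  let ?X = "\<lambda>x. qpoch_inf (x * b) q * qpoch_inf (x * c) q * qpoch_inf (x * d) q * aw_integral q x b c d"
  have "?X a * qpoch_inf (0 * (b * c * d)) q = qpoch_inf (a * (b * c * d)) q * ?X 0"
  proof (rule q_iterate[OF q, where B = "\<lambda>x. 1 - x * b * c * d" and s = a
        and \<psi> = "\<lambda>x. qpoch_inf (x * (b * c * d)) q" and X = ?X])
    fix n
    define y where "y = a * q ^ n"
    have y: "norm y < 1" unfolding y_def by (rule norm_mult_power_lt_1[OF q a])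
    have "?X y = qpoch_inf (q * (y * b)) q * qpoch_inf (q * (y * c)) q * qpoch_inf (q * (y * d)) q *
        ((1 - y * b) * (1 - y * c) * (1 - y * d) * aw_integral q y b c d)"
      using qpoch_inf_rec[OF q, of "y * b"] qpoch_inf_rec[OF q, of "y * c"] qpoch_inf_rec[OF q, of "y * d"]
      by (simp add: mult_ac)
    also have "\<dots> = (1 - y * b * c * d) * ?X (q * y)"
      unfolding aw_integral_mult_q[OF q y b c d] by (simp only: mult_ac)
    finally show "?X y = (1 - y * b * c * d) * ?X (q * y)" .
    show "qpoch_inf (y * (b * c * d)) q = (1 - y * b * c * d) * qpoch_inf (q * y * (b * c * d)) q"
      using qpoch_inf_rec[OF q, of "y * (b * c * d)"] by (simp add: mult_ac)
  next
    have "continuous_on (cball 0 (norm a)) (\<lambda>x. integral (cbox (-pi) pi) (\<lambda>\<theta>. aw_weight q x b c d (cis \<theta>)))"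
      by (intro integral_continuous_on_param aw_weight_continuous_param a b c d)
    then have "continuous_on (cball 0 (norm a)) (\<lambda>x. aw_integral q x b c d)"
      by (simp add: aw_integral_def)
    then have "(\<lambda>n. aw_integral q (a * q ^ n) b c d) \<longlonglongrightarrow> aw_integral q 0 b c d"
    proof (rule continuous_on_tendsto_compose[OF _ power_q_tendsto_0[OF q]])
      show "\<forall>\<^sub>F n in sequentially. a * q ^ n \<in> cball 0 (norm a)"
        using q by (auto simp: norm_mult norm_power mult_left_le power_le_one)
    qed simp
    then show "(\<lambda>n. ?X (a * q ^ n)) \<longlonglongrightarrow> ?X 0"
      by (intro tendsto_intros qpoch_inf_tendsto[OF q] power_q_tendsto_0[OF q])
    show "(\<lambda>n. qpoch_inf (a * q ^ n * (b * c * d)) q) \<longlonglongrightarrow> qpoch_inf (0 * (b * c * d)) q"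
      by (intro tendsto_intros qpoch_inf_tendsto[OF q] power_q_tendsto_0[OF q])
  qed
  then show ?thesis by (simp add: qpoch_inf_0[OF q] mult_ac)
qed

text \<open>Symmetry brings the next remaining parameter to the front. Once one parameter is 0, so
  is the product of all four; the right-hand factor of the later rounds is 1 and only pair products
  accumulate.\<close>

lemma aw_integral_reduce_0:
  assumes a: "norm a < 1" and b: "norm b < 1" and c: "norm c < 1" and d: "norm d < 1"
  shows "qpoch_inf (a * b) q * qpoch_inf (a * c) q * qpoch_inf (a * d) q *
      qpoch_inf (b * c) q * qpoch_inf (b * d) q * qpoch_inf (c * d) q * aw_integral q a b c d =
    qpoch_inf (a * b * c * d) q * aw_integral q 0 0 0 0"
proof -
  have z: "norm (0 :: complex) < 1" by simp
  have 1: "qpoch_inf (b * c) q * qpoch_inf (b * d) q * aw_integral q 0 b c d = aw_integral q 0 0 c d"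
    using aw_integral_reduce[OF b z c d] aw_integral_commute(1)[of q b 0 c d] by (simp add: qpoch_inf_0[OF q])
  have 2: "qpoch_inf (c * d) q * aw_integral q 0 0 c d = aw_integral q 0 0 0 d"
    using aw_integral_reduce[OF c z z d] aw_integral_commute(2)[of q c 0 0 d] by (simp add: qpoch_inf_0[OF q])
  have 3: "aw_integral q 0 0 0 d = aw_integral q 0 0 0 0"
    using aw_integral_reduce[OF d z z z] aw_integral_commute(3)[of q d 0 0 0] by (simp add: qpoch_inf_0[OF q])
  have "qpoch_inf (a * b) q * qpoch_inf (a * c) q * qpoch_inf (a * d) q *
      qpoch_inf (b * c) q * qpoch_inf (b * d) q * qpoch_inf (c * d) q * aw_integral q a b c d =
      qpoch_inf (c * d) q * (qpoch_inf (b * c) q * qpoch_inf (b * d) q *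
      (qpoch_inf (a * b) q * qpoch_inf (a * c) q * qpoch_inf (a * d) q * aw_integral q a b c d))"
    by (simp only: mult_ac)
  also have "\<dots> = qpoch_inf (a * b * c * d) q *
      (qpoch_inf (c * d) q * (qpoch_inf (b * c) q * qpoch_inf (b * d) q * aw_integral q 0 b c d))"
    unfolding aw_integral_reduce[OF a b c d] by (simp only: mult_ac)
  finally show ?thesis unfolding 1 2 3 .
qed

text \<open>Euler's identity between partitions into distinct and into odd parts: both
  \<open>(q;q)_inf (-q;q)_inf\<close> and the quotient of \<open>(q;q)_inf\<close> by
  \<open>(q;q^2)_inf\<close> are \<open>(q^2;q^2)_inf\<close>.\<close>

lemma euler_qpoch: "qpoch_inf (- q) q * qpoch_inf q (q\<^sup>2) = 1"
proof -
  have "qpoch_inf q q \<noteq> 0" by (rule qpoch_inf_nonzero_norm[OF q q])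
  moreover have "qpoch_inf q q * (qpoch_inf (- q) q * qpoch_inf q (q\<^sup>2)) = qpoch_inf q q"
    using qpoch_inf_mult_uminus[OF q, of q] qpoch_inf_even_odd[OF q, of q]
    by (simp add: mult_ac power2_eq_square)
  ultimately show ?thesis by simp
qed

text \<open>For the parameters \<open>q, -q, s, -s\<close> with \<open>s\<^sup>2 = q\<close> the weight is \<open>(1 - z\<^sup>2) (1 - z\<^sup>-\<^sup>2)\<close>.\<close>

lemma aw_integral_0: "qpoch_inf q q * aw_integral q 0 0 0 0 = 4 * of_real pi"
proof -
  define s where "s = csqrt q"
  have s2: "s\<^sup>2 = q" by (simp add: s_def)
  have "norm s ^ 2 < 1" using q s2 by (metis norm_power)
  then have s: "norm s < 1" by (simp add: abs_square_less_1)
  have q2: "norm (q\<^sup>2) < 1" using q by (simp add: norm_power power_less_one_iff abs_square_less_1)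
  have w: "aw_weight q q (-q) s (-s) (cis \<theta>) = of_real (2 - 2 * cos (2 * \<theta>))" for \<theta>
  proof -
    \<comment> \<open>The pairs \<open>q, -q\<close> and \<open>s, -s\<close> give the odd and the
      even factors of \<open>(q z^2;q)_inf\<close> in base \<open>q^2\<close>. Against the numerator
      of the weight only its first factor \<open>1 - z^2\<close> survives.\<close>
    have D: "aw_den q q (-q) s (-s) z = qpoch_inf (q * z\<^sup>2) q" for z
    proof -
      have "aw_den q q (-q) s (-s) z = (qpoch_inf (q * z) q * qpoch_inf (- (q * z)) q) *
          (qpoch_inf (s * z) q * qpoch_inf (- (s * z)) q)"
        by (simp add: aw_den_def mult_ac)
      also have "\<dots> = qpoch_inf (q * (q * z\<^sup>2)) (q\<^sup>2) * qpoch_inf (q * z\<^sup>2) (q\<^sup>2)"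
        unfolding qpoch_inf_mult_uminus[OF q] power_mult_distrib s2 by (simp add: power2_eq_square mult_ac)
      also have "\<dots> = qpoch_inf (q * z\<^sup>2) q"
        by (subst qpoch_inf_even_odd[OF q, of "q * z\<^sup>2"]) (simp add: mult_ac)
      finally show ?thesis .
    qed
    have nz: "qpoch_inf (q * (cis t)\<^sup>2) q \<noteq> 0" for t
      using q by (intro qpoch_inf_nonzero_norm[OF q]) (simp add: norm_mult norm_power)
    have "aw_weight q q (-q) s (-s) (cis \<theta>) = (1 - (cis \<theta>)\<^sup>2) * (1 - (cis (-\<theta>))\<^sup>2)"
      unfolding aw_weight_def D cis_inverse
        qpoch_inf_rec[OF q, of "(cis \<theta>)\<^sup>2"] qpoch_inf_rec[OF q, of "(cis (-\<theta>))\<^sup>2"]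
      using nz[of \<theta>] nz[of "-\<theta>"] by simp
    also have "\<dots> = of_real (2 - 2 * cos (2 * \<theta>))"
    proof -
      have "(cis \<theta>)\<^sup>2 = cis (2 * \<theta>)" "(cis (-\<theta>))\<^sup>2 = cis (- (2 * \<theta>))"
        by (simp_all add: power2_eq_square cis_mult)
      moreover have "(1 - cis (2 * \<theta>)) * (1 - cis (- (2 * \<theta>))) = 2 - (cis (2 * \<theta>) + cis (- (2 * \<theta>)))"
        by (simp add: algebra_simps cis_mult)
      ultimately show ?thesis by (simp add: complex_eq_iff)
    qed
    finally show ?thesis .
  qed
  have "((\<lambda>\<theta>. 2 - 2 * cos (2 * \<theta>)) has_integral ((2 * pi - sin (2 * pi)) - (2 * (-pi) - sin (2 * (-pi))))) {-pi..pi}"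
    by (rule fundamental_theorem_of_calculus)
       (auto intro!: derivative_eq_intros simp flip: has_real_derivative_iff_has_vector_derivative)
  then have "((\<lambda>\<theta>. 2 - 2 * cos (2 * \<theta>)) has_integral (4 * pi)) {-pi..pi}" by simp
  then have "((\<lambda>\<theta>. complex_of_real (2 - 2 * cos (2 * \<theta>))) has_integral of_real (4 * pi)) {-pi..pi}"
    by (rule has_integral_of_real)
  then have I: "aw_integral q q (-q) s (-s) = 4 * of_real pi"
    unfolding aw_integral_def w by (simp add: integral_unique)
  define A B Q where "A = qpoch_inf (- q) q" and "B = qpoch_inf q (q\<^sup>2)" and "Q = qpoch_inf q q"
  have AB: "A * B = 1" unfolding A_def B_def by (rule euler_qpoch)
  have nq: "q \<noteq> 1" "q \<noteq> -1" "1 + q \<noteq> 0" "1 - q \<noteq> 0"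
    using q by (auto simp: add_eq_0_iff)
  have qs: "qpoch_inf (q * s) q * qpoch_inf (- (q * s)) q = B / (1 - q)"
    unfolding qpoch_inf_mult_uminus[OF q] B_def power_mult_distrib s2
    using qpoch_inf_rec[OF q2, of q] nq by (simp add: power2_eq_square)
  have A2: "qpoch_inf (- (q * q)) q = A / (1 + q)"
    using qpoch_inf_rec[OF q, of "- q"] nq by (simp add: A_def)
  have Q2: "qpoch_inf (q * q * q) q = Q / ((1 - q) * (1 - q * q))"
  proof -
    have "q * q \<noteq> 1" using q nq by (metis square_eq_1_iff)
    then show ?thesis
      using qpoch_inf_rec[OF q, of q] qpoch_inf_rec[OF q, of "q * q"] nq by (simp add: Q_def mult_ac)
  qed
  have Q0: "Q \<noteq> 0" unfolding Q_def by (rule qpoch_inf_nonzero_norm[OF q q])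
  have "qpoch_inf (- (q * q)) q * qpoch_inf (q * s) q * qpoch_inf (- (q * s)) q *
      qpoch_inf (- (q * s)) q * qpoch_inf (q * s) q * qpoch_inf (- (s * s)) q * aw_integral q q (-q) s (-s)
    = qpoch_inf (q * q * (s * s)) q * aw_integral q 0 0 0 0"
    using aw_integral_reduce_0[of q "-q" s "-s"] q s by (simp add: mult_ac)
  moreover have "s * s = q" using s2 by (simp add: power2_eq_square)
  ultimately have "qpoch_inf (- (q * q)) q * (qpoch_inf (q * s) q * qpoch_inf (- (q * s)) q)\<^sup>2 * A * (4 * of_real pi)
    = qpoch_inf (q * q * q) q * aw_integral q 0 0 0 0"
    by (simp add: I A_def power2_eq_square mult_ac)
  then have e1: "A / (1 + q) * (B / (1 - q))\<^sup>2 * A * (4 * of_real pi) = Q / ((1 - q) * (1 - q * q)) * aw_integral q 0 0 0 0"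
    unfolding A2 qs Q2 .
  \<comment> \<open>The infinite products combine to \<open>(A * B)^2\<close>, which is 1 by Euler's
    identity, over the same denominator as on the other side of \<open>e1\<close>.\<close>
  have e2: "A / (1 + q) * (B / (1 - q))\<^sup>2 * A = (A * B)\<^sup>2 / ((1 - q) * (1 - q * q))"
  proof -
    have "(1 - q) * (1 - q * q) = (1 + q) * (1 - q)\<^sup>2" by (simp add: algebra_simps power2_eq_square)
    then show ?thesis unfolding \<open>(1 - q) * (1 - q * q) = _\<close> by (simp add: power2_eq_square mult_ac)
  qed
  have "(1 - q) * (1 - q * q) \<noteq> 0"
    using nq by (metis mult_eq_0_iff right_minus_eq square_eq_1_iff)
  then show ?thesis
    using e1 unfolding e2 AB by (simp add: Q_def)
qed

theorem askey_wilson_integral: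
  assumes a: "norm a < 1" and b: "norm b < 1" and c: "norm c < 1" and d: "norm d < 1"
  shows "qpoch_inf q q * (qpoch_inf (a * b) q * qpoch_inf (a * c) q * qpoch_inf (a * d) q *
      qpoch_inf (b * c) q * qpoch_inf (b * d) q * qpoch_inf (c * d) q) * aw_integral q a b c d =
    4 * of_real pi * qpoch_inf (a * b * c * d) q"
proof -
  have "qpoch_inf q q * (qpoch_inf (a * b) q * qpoch_inf (a * c) q * qpoch_inf (a * d) q *
      qpoch_inf (b * c) q * qpoch_inf (b * d) q * qpoch_inf (c * d) q) * aw_integral q a b c d
    = qpoch_inf (a * b * c * d) q * (qpoch_inf q q * aw_integral q 0 0 0 0)"
    using aw_integral_reduce_0[OF a b c d] by (simp add: mult_ac)
  then show ?thesis unfolding aw_integral_0 by simp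
qed

section \<open>The half circle and the exchange of the two integrations\<close>

lemma aw_integral_half:
  assumes a: "norm a < 1" and b: "norm b < 1" and c: "norm c < 1" and d: "norm d < 1"
  shows "integral {0..pi} (\<lambda>\<theta>. aw_weight q a b c d (cis \<theta>)) = aw_integral q a b c d / 2"
proof -
  let ?f = "\<lambda>\<theta>. aw_weight q a b c d (cis \<theta>)"
  have "?f (- \<theta>) = ?f \<theta>" for \<theta>
    unfolding aw_weight_def cis_inverse by (simp add: mult_ac)
  then have "integral {-pi..0} ?f = integral {0..pi} ?f"
    using Henstock_Kurzweil_Integration.integral_reflect_real[of pi 0 ?f] by simp
  moreover have "integral {-pi..0} ?f + integral {0..pi} ?f = integral {-pi..pi} ?f"
    by (rule Henstock_Kurzweil_Integration.integral_combine)
       (auto intro!: integrable_continuous_real continuous_on_subset[OF aw_weight_continuous[OF q a b c d]])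
  ultimately have "2 * integral {0..pi} ?f = aw_integral q a b c d" by (simp add: aw_integral_def)
  then show ?thesis by (metis nonzero_mult_div_cancel_left zero_neq_numeral)
qed

text \<open>Both lattices lie in the disc of radius \<open>r\<close>, and compactness bounds
  \<open>G\<close> there uniformly in \<theta>. The powers of \<open>q\<close> then give a geometric
  majorant, so the Jackson sum converges uniformly and may be integrated termwise.\<close>

lemma integral_jackson_integral_swap:
  assumes G: "continuous_on (cball 0 r \<times> {a..b}) (\<lambda>(x, \<theta>). G x \<theta>)"
    and u: "norm u \<le> r" and v: "norm v \<le> r"
  shows "integral {a..b} (\<lambda>\<theta>::real. jackson_integral q u v (\<lambda>x. G x \<theta>)) =
    jackson_integral q u v (\<lambda>x. integral {a..b} (G x))"
proof -
  have "compact ((\<lambda>(x, \<theta>). G x \<theta>) ` (cball 0 r \<times> {a..b}))"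
    by (intro compact_continuous_image G compact_Times) auto
  then obtain K where "\<forall>y \<in> (\<lambda>(x, \<theta>). G x \<theta>) ` (cball 0 r \<times> {a..b}). norm y \<le> K"
    using compact_imp_bounded bounded_iff by metis
  then have K: "norm (G x \<theta>) \<le> K" if "norm x \<le> r" "\<theta> \<in> {a..b}" for x \<theta>
    using that by force
  have lat: "norm (w * q ^ n) \<le> r" if "norm w \<le> r" for w n
  proof -
    have "norm w * norm q ^ n \<le> norm w" using q by (intro mult_left_le power_le_one) auto
    then show ?thesis using that by (simp add: norm_mult norm_power)
  qed
  have cont: "continuous_on {a..b} (G x)" if "norm x \<le> r" for x
  proof -
    have "continuous_on {a..b} (\<lambda>\<theta>. (x, \<theta>))" by (intro continuous_intros)
    from continuous_on_compose2[OF G this] that show ?thesis by force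
  qed
  define t where "t n \<theta> = (v * G (v * q ^ n) \<theta> - u * G (u * q ^ n) \<theta>) * q ^ n" for n \<theta>
  have tcont: "continuous_on {a..b} (t n)" for n
    unfolding t_def by (intro continuous_intros cont lat u v)
  have unif: "uniform_limit {a..b} (\<lambda>N \<theta>. \<Sum>n<N. t n \<theta>) (\<lambda>\<theta>. \<Sum>n. t n \<theta>) sequentially"
  proof (rule Weierstrass_m_test)
    show "summable (\<lambda>n. (norm v * K + norm u * K) * norm q ^ n)"
      using q by (intro summable_mult summable_geometric) auto
    fix n \<theta> assume \<theta>: "\<theta> \<in> {a..b}"
    have "norm (v * G (v * q ^ n) \<theta> - u * G (u * q ^ n) \<theta>) \<le>
        norm (v * G (v * q ^ n) \<theta>) + norm (u * G (u * q ^ n) \<theta>)"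
      by (rule norm_triangle_ineq4)
    also have "\<dots> \<le> norm v * K + norm u * K"
      unfolding norm_mult[of v] norm_mult[of u] by (intro add_mono mult_left_mono K lat u v \<theta>) auto
    finally show "norm (t n \<theta>) \<le> (norm v * K + norm u * K) * norm q ^ n"
      unfolding t_def norm_mult[of _ "q ^ n"] norm_power by (intro mult_right_mono) auto
  qed
  obtain I J where I: "\<And>N. ((\<lambda>\<theta>. \<Sum>n<N. t n \<theta>) has_integral I N) (cbox a b)"
    and J: "((\<lambda>\<theta>. \<Sum>n. t n \<theta>) has_integral J) (cbox a b)" and IJ: "I \<longlonglongrightarrow> J"
    by (rule uniform_limit_integral_cbox[OF unif[folded cbox_interval]])
       (use tcont in \<open>auto intro!: continuous_on_sum\<close>)
  have "((\<lambda>\<theta>. \<Sum>n<N. t n \<theta>) has_integral (\<Sum>n<N. integral {a..b} (t n))) {a..b}" for N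
    by (intro has_integral_sum integrable_integral integrable_continuous_real tcont) auto
  then have IN: "I N = (\<Sum>n<N. integral {a..b} (t n))" for N
    using has_integral_unique[OF I[of N, unfolded cbox_interval]] by blast
  have "(\<lambda>n. integral {a..b} (t n)) sums J" unfolding sums_def IN[symmetric] by (rule IJ)
  moreover have "integral {a..b} (t n) = (v * integral {a..b} (G (v * q ^ n)) - u * integral {a..b} (G (u * q ^ n))) * q ^ n" for n
  proof -
    have "G (v * q ^ n) integrable_on {a..b}" "G (u * q ^ n) integrable_on {a..b}"
      by (intro integrable_continuous_real cont lat u v)+
    then have "integral {a..b} (\<lambda>\<theta>. v * G (v * q ^ n) \<theta> - u * G (u * q ^ n) \<theta>) =
        v * integral {a..b} (G (v * q ^ n)) - u * integral {a..b} (G (u * q ^ n))"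
      by (subst integral_diff) (auto intro: integrable_on_mult_right)
    then show ?thesis unfolding t_def by simp
  qed
  ultimately have "jackson_integral q u v (\<lambda>x. integral {a..b} (G x)) = (1 - q) * J"
    by (simp add: jackson_integral_def sums_iff)
  also have "\<dots> = integral {a..b} (\<lambda>\<theta>. (1 - q) * (\<Sum>n. t n \<theta>))"
    using J by (simp add: integral_unique)
  finally show ?thesis unfolding jackson_integral_def t_def by (rule sym)
qed

end

section \<open>Assembly of the identity from the two evaluations\<close>

theorem theorem5p5:
  fixes q \<alpha> a b c d u v :: complex
  assumes "norm q < 1"
    and "Max {norm a, norm b, norm c, norm d, norm u, norm v} < 1"
    and "u \<noteq> 0" and "v \<noteq> 0"
    and "\<And>n::nat. 1 - (u / v) * q ^ n \<noteq> 0"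
    and "\<And>n::nat. 1 - (q * v / u) * q ^ n \<noteq> 0"
    and "\<And>n::nat. 1 - (\<alpha> * d * v) * q ^ n \<noteq> 0"
  shows "qpoch_inf q q / (2 * of_real pi) *
      integral {0..pi} (\<lambda>\<theta>::real.
        hfun q (cos (2 * \<theta>)) 1 / hfuns q (cos \<theta>) [a, b, c, u, v] *
        basic_hyp [\<alpha>, v * exp (\<i> * of_real \<theta>), v * exp (- \<i> * of_real \<theta>)]
                  [\<alpha> * d * v, u * v] q (d * u))
    = qpoch_inf (d * v) q /
        ((1 - q) * v *
         qpochs_inf [q, u / v, q * v / u, \<alpha> * d * v, u * v, a * b, a * c, b * c] q) *
      jackson_integral q u v (\<lambda>x.
        qpochs_inf [q * x / u, q * x / v, a * b * c * x, \<alpha> * d * x] q /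
        qpochs_inf [a * x, b * x, c * x, d * x] q)"
proof -
  note q = assms(1) and u0 = assms(3) and v0 = assms(4)
  have a: "norm a < 1" and b: "norm b < 1" and c: "norm c < 1" and d: "norm d < 1"
    and u: "norm u < 1" and v: "norm v < 1"
    using assms(2) by simp_all
  have uv: "u / v * q ^ n \<noteq> 1" and vu: "q * v / u * q ^ n \<noteq> 1" and adv: "\<alpha> * d * v * q ^ n \<noteq> 1" for n
    using assms(5-7)[of n] by simp_all
  define r where "r = max (norm u) (norm v)"
  have r: "r < 1" "norm u \<le> r" "norm v \<le> r" using u v by (auto simp: r_def)
  define P where "P x = qpoch_inf x q" for x
  \<comment> \<open>The part of the double integrand that is free of \<theta>; the rest is the
    Askey-Wilson weight with \<open>x\<close> as fourth parameter.\<close>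
  define R where "R x = P (q * x / u) * P (q * x / v) * P (\<alpha> * d * x) / P (d * x)" for x
  define C where "C = (1 - q) * v * P q * P (u / v) * P (q * v / u) * P (\<alpha> * d * v) * P (u * v)"
  have P0: "P x \<noteq> 0" if "norm x < 1" for x
    unfolding P_def by (rule qpoch_inf_nonzero_norm[OF q that])
  have C0: "C \<noteq> 0"
    using q v0 qpoch_inf_nonzero[OF q uv] qpoch_inf_nonzero[OF q vu] qpoch_inf_nonzero[OF q adv]
      P0[OF q] P0[OF norm_mult_lt_1[OF u v]] by (auto simp: C_def P_def)
  \<comment> \<open>The Jackson evaluation is read backwards: for fixed \<theta> the 3phi2 is traded
    for the Jackson integral that produces it. The exponentials have norm 1, so
    \<open>norm u < 1\<close> and \<open>norm v < 1\<close> keep all denominators on the lattices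
    nonzero.\<close>
  have integrand: "hfun q (cos (2 * \<theta>)) 1 / hfuns q (cos \<theta>) [a, b, c, u, v] *
        basic_hyp [\<alpha>, v * exp (\<i> * of_real \<theta>), v * exp (- \<i> * of_real \<theta>)] [\<alpha> * d * v, u * v] q (d * u)
      = P (d * v) / C * jackson_integral q u v (\<lambda>x. R x * aw_weight q a b c x (cis \<theta>))" for \<theta> :: real
  proof -
    define z w where "z = cis \<theta>" and "w = cis (- \<theta>)"
    have e: "exp (\<i> * of_real \<theta>) = z" "exp (- \<i> * of_real \<theta>) = w"
      by (simp_all add: z_def w_def cis_conv_exp)
    have e2: "exp (\<i> * of_real (2 * \<theta>)) = z\<^sup>2" "exp (- \<i> * of_real (2 * \<theta>)) = w\<^sup>2"
      unfolding e[symmetric] by (simp_all add: power2_eq_square mult_exp_exp algebra_simps)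
    have zw: "z * w = 1" "inverse z = w" "norm z = 1" "norm w = 1"
      by (simp_all add: z_def w_def cis_mult)
    have nz: "s * x * q ^ n \<noteq> 1" if "norm s = 1" "norm x < 1" for s x n
    proof -
      have "norm (s * x * q ^ n) < 1" using that norm_mult_power_lt_1[OF q, of "s * x" n] by (simp add: norm_mult)
      then show ?thesis by force
    qed
    define W where "W = P (z\<^sup>2) * P (w\<^sup>2) / ((P (a * z) * P (a * w)) * (P (b * z) * P (b * w)) * (P (c * z) * P (c * w)))"
    define B where "B = basic_hyp [\<alpha>, v * z, v * w] [\<alpha> * d * v, u * v] q (d * u)"
    \<comment> \<open>\<open>H\<close> is \<open>h(cos \<theta>;u,v)\<close>. It is contributed by
      the Andrews-Askey evaluation, while \<open>W\<close> holds the factors of the weight without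
      \<open>x\<close>.\<close>
    define H where "H = P (z * u) * P (z * v) * P (w * u) * P (w * v)"
    have H0: "H \<noteq> 0"
      unfolding H_def P_def using qpoch_inf_nonzero[OF q nz] zw u v by simp
    have stuv: "z * w * u * v = u * v" by (simp add: zw)
    have J: "jackson_integral q u v (\<lambda>x. aa_weight q u v z w x * (P (\<alpha> * d * x) / P (d * x))) = C / (P (d * v) * H) * B"
    proof -
      have "z * w * u * v * q ^ n \<noteq> 1" for n
        using norm_mult_power_lt_1[OF q norm_mult_lt_1[OF u v], of n] unfolding stuv by force
      moreover have "z * u * q ^ n \<noteq> 1" "z * v * q ^ n \<noteq> 1" "w * u * q ^ n \<noteq> 1" "w * v * q ^ n \<noteq> 1" for n
        using nz zw u v by simp_all
      ultimately show ?thesis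
        using jackson_integral_eq_basic_hyp[OF q u0 v0 _ _ _ _ d u v adv uv vu, of z w]
        unfolding stuv P_def C_def H_def B_def by (simp add: mult.commute[of v] mult.assoc)
    qed
    have "jackson_integral q u v (\<lambda>x. R x * aw_weight q a b c x z) =
        jackson_integral q u v (\<lambda>x. W * (aa_weight q u v z w x * (P (\<alpha> * d * x) / P (d * x))))"
      by (rule arg_cong[where f = "jackson_integral q u v"])
         (simp add: fun_eq_iff R_def W_def P_def aa_weight_def aw_weight_def aw_den_def zw mult_ac)
    also have "\<dots> = W * jackson_integral q u v (\<lambda>x. aa_weight q u v z w x * (P (\<alpha> * d * x) / P (d * x)))"
    proof (rule jackson_integral_cmult[OF q], rule jackson_summableI[OF q])
      have L: "(\<lambda>n. aa_weight q u v z w (y * q ^ n) * (P (\<alpha> * d * (y * q ^ n)) / P (d * (y * q ^ n)))) \<longlonglongrightarrow>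
          1 * (P (\<alpha> * d * 0) / P (d * 0))" for y
        unfolding P_def
        by (intro tendsto_mult tendsto_divide tendsto_const aa_weight_tendsto[OF q] qpoch_inf_tendsto[OF q] power_q_tendsto_0[OF q])
           (simp add: qpoch_inf_0[OF q])
      show "(\<lambda>n. aa_weight q u v z w (u * q ^ n) * (P (\<alpha> * d * (u * q ^ n)) / P (d * (u * q ^ n)))) \<longlonglongrightarrow>
          1 * (P (\<alpha> * d * 0) / P (d * 0))"
        "(\<lambda>n. aa_weight q u v z w (v * q ^ n) * (P (\<alpha> * d * (v * q ^ n)) / P (d * (v * q ^ n)))) \<longlonglongrightarrow>
          1 * (P (\<alpha> * d * 0) / P (d * 0))"
        by (rule L)+
    qed
    finally have "P (d * v) / C * jackson_integral q u v (\<lambda>x. R x * aw_weight q a b c x z) = W / H * B"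
      unfolding J using C0 H0 P0[OF norm_mult_lt_1[OF d v]] by simp
    moreover have "hfun q (cos (2 * \<theta>)) 1 / hfuns q (cos \<theta>) [a, b, c, u, v] = W / H"
      unfolding hfuns_def
      by (simp only: list.map prod_list.Cons prod_list.Nil hfun_cos qpochs_inf_def e e2 W_def H_def P_def)
         (simp add: mult_ac)
    ultimately show ?thesis by (simp only: B_def e z_def)
  qed
  have cont: "continuous_on (cball 0 r \<times> {0..pi}) (\<lambda>(x, \<theta>). R x * aw_weight q a b c x (cis \<theta>))"
  proof -
    have "P (d * x) \<noteq> 0" if "norm x \<le> r" for x
      using that r by (intro P0 norm_mult_lt_1 d) simp
    then have nz: "P (d * fst p) \<noteq> 0" if "p \<in> cball 0 r \<times> {0..pi}" for p :: "complex \<times> real"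
      using that by (cases p) simp
    have "continuous_on (cball 0 r \<times> {0..pi}) (\<lambda>p. R (fst p))"
      using nz unfolding R_def P_def
      by (intro continuous_on_divide continuous_on_mult qpoch_inf_continuous[OF q] continuous_on_fst
          continuous_on_id continuous_on_const ballI) (use u0 v0 in simp_all)
    \<comment> \<open>Joint continuity was established with the varying parameter in the first slot,
      so \<open>x\<close> and \<open>a\<close> change places.\<close>
    moreover have "(\<lambda>p :: complex \<times> real. aw_weight q a b c (fst p) (cis (snd p))) =
        (\<lambda>(x, \<theta>). aw_weight q x b c a (cis \<theta>))"
      by (auto simp: fun_eq_iff aw_weight_def aw_den_def mult_ac)
    then have "continuous_on (cball 0 r \<times> {0..pi}) (\<lambda>p. aw_weight q a b c (fst p) (cis (snd p)))"
      by (simp only:) (rule aw_weight_continuous_param[OF q b c a r(1)])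
    ultimately show ?thesis unfolding split_beta by (rule continuous_on_mult)
  qed
  \<comment> \<open>Here \<open>(a b c x;q)_inf\<close> and the denominators in \<open>a x\<close>,
    \<open>b x\<close>, \<open>c x\<close> arise from the Askey-Wilson value; the half circle turns
    \<open>4 pi\<close> into \<open>2 pi\<close>.\<close>
  have inner: "integral {0..pi} (\<lambda>\<theta>. R x * aw_weight q a b c x (cis \<theta>)) =
      2 * of_real pi / (P q * P (a * b) * P (a * c) * P (b * c)) *
        (qpochs_inf [q * x / u, q * x / v, a * b * c * x, \<alpha> * d * x] q / qpochs_inf [a * x, b * x, c * x, d * x] q)"
    if x: "norm x < 1" for x
  proof -
    have n: "P q \<noteq> 0" "P (a * b) \<noteq> 0" "P (a * c) \<noteq> 0" "P (b * c) \<noteq> 0" "P (a * x) \<noteq> 0" "P (b * x) \<noteq> 0" "P (c * x) \<noteq> 0"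
      using a b c x q by (auto intro!: P0 norm_mult_lt_1)
    have "aw_integral q a b c x = 4 * of_real pi * P (a * b * c * x) /
        (P q * (P (a * b) * P (a * c) * P (a * x) * P (b * c) * P (b * x) * P (c * x)))"
      using askey_wilson_integral[OF q a b c x] n unfolding P_def by (simp add: eq_divide_eq mult_ac)
    then have "integral {0..pi} (\<lambda>\<theta>. R x * aw_weight q a b c x (cis \<theta>)) =
        R x * (2 * of_real pi * P (a * b * c * x) /
        (P q * (P (a * b) * P (a * c) * P (a * x) * P (b * c) * P (b * x) * P (c * x))))"
      using aw_integral_half[OF q a b c x] by (simp add: mult_ac)
    then show ?thesis by (simp add: R_def qpochs_inf_def P_def mult_ac)
  qed
  define Y where "Y = jackson_integral q u v (\<lambda>x.
        qpochs_inf [q * x / u, q * x / v, a * b * c * x, \<alpha> * d * x] q / qpochs_inf [a * x, b * x, c * x, d * x] q)"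
  have "integral {0..pi} (\<lambda>\<theta>. jackson_integral q u v (\<lambda>x. R x * aw_weight q a b c x (cis \<theta>)))
      = jackson_integral q u v (\<lambda>x. integral {0..pi} (\<lambda>\<theta>. R x * aw_weight q a b c x (cis \<theta>)))"
    by (rule integral_jackson_integral_swap[OF q cont r(2,3)])
  also have "\<dots> = jackson_integral q u v (\<lambda>x. 2 * of_real pi / (P q * P (a * b) * P (a * c) * P (b * c)) *
        (qpochs_inf [q * x / u, q * x / v, a * b * c * x, \<alpha> * d * x] q / qpochs_inf [a * x, b * x, c * x, d * x] q))"
    by (rule jackson_integral_cong[OF q]) (intro inner norm_mult_power_lt_1[OF q] u v)+
  also have "\<dots> = 2 * of_real pi / (P q * P (a * b) * P (a * c) * P (b * c)) * Y"
    unfolding Y_def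
  proof (rule jackson_integral_cmult[OF q], rule jackson_summableI[OF q])
    let ?f = "\<lambda>x. qpochs_inf [q * x / u, q * x / v, a * b * c * x, \<alpha> * d * x] q / qpochs_inf [a * x, b * x, c * x, d * x] q"
    have L: "(\<lambda>n. ?f (y * q ^ n)) \<longlonglongrightarrow> ?f 0" for y
      unfolding qpochs_inf_def list.map prod_list.Cons prod_list.Nil divide_inverse
      by (intro tendsto_mult tendsto_inverse tendsto_const qpoch_inf_tendsto[OF q] power_q_tendsto_0[OF q])
         (simp add: qpoch_inf_0[OF q])
    show "(\<lambda>n. ?f (u * q ^ n)) \<longlonglongrightarrow> ?f 0" "(\<lambda>n. ?f (v * q ^ n)) \<longlonglongrightarrow> ?f 0" by (rule L)+
  qed
  finally have "integral {0..pi} (\<lambda>\<theta>. P (d * v) / C * jackson_integral q u v (\<lambda>x. R x * aw_weight q a b c x (cis \<theta>)))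
      = P (d * v) / C * (2 * of_real pi / (P q * P (a * b) * P (a * c) * P (b * c)) * Y)"
    by simp
  then show ?thesis
    unfolding integrand Y_def[symmetric] using P0[OF q]
    by (simp add: qpochs_inf_def C_def P_def mult_ac)
qed

end
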